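(* Let $X$ be a nearly uniformly convex (NUC) Banach space and let $(A,B)$ be a pair of nonempty bounded closed convex subsets of $X$ which is a proximal parallel pair. Assume that $(A,B)$ has the rectangle property and the property $UC$. Let $T: A\cup B \to A\cup B$ be a continuous and asymptotically relatively nonexpansive map satisfying $T(A)\subseteq A$ and $T(B)\subseteq B$. Then there exist $x\in A$ and $y\in B$ such that $Tx=x$, $Ty=y$ and $\|x-y\| = \operatorname{dist}(A,B)$.
   Context: For nonempty subsets $A,B$ of a Banach space $X$, $\operatorname{dist}(A,B)=\inf\{\|a-b\|: a\in A,\ b\in B\}$. A Banach space $X$ has uniformly Kadec-Klee (UKK) norm if for every $\epsilon>0$ there is $\delta>0$ such that whenever $\{x_n\}$ is a sequence in the closed unit ball of $X$ converging weakly to $x_0$ with $\inf\{\|x_n-x_m\|: n\neq m\}>\epsilon$, then $\|x_0\|\le 1-\delta$. $X$ is nearly uniformly convex (NUC) if it is reflexive and has UKK norm. The pair $(A,B)$ is a proximal pair if for each $(x,y)\in A\times B$ there is $(x_1,y_1)\in A\times B$ with $\|x-y_1\|=\operatorname{dist}(A,B)=\|y-x_1\|$. It is a sharp proximal pair if in addition, for each $(x,y)\in A\times B$, such a pair $(x_1,y_1)$ is unique. It is a proximal parallel pair if it is a sharp proximal pair and there is a unique $h\in X$ with $B=A+h$; in this case, for $a\in A$, $a+h$ is the proximal point in $B$ to $a$ (so $\|h\|=\operatorname{dist}(A,B)$). A convex proximal parallel pair $(A,B)$ with $B=A+h$ has the rectangle property if $\|x+h-y\|=\|y+h-x\|$ for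 all $x,y\in A$. $(A,B)$ has the property $UC$ if whenever $\{x_n\},\{z_n\}$ are sequences in $A$ and $\{y_n\}$ is a sequence in $B$ with $\lim\|x_n-y_n\|=\operatorname{dist}(A,B)$ and $\lim\|z_n-y_n\|=\operatorname{dist}(A,B)$, then $\lim\|x_n-z_n\|=0$. A map $T:A\cup B\to A\cup B$ is asymptotically relatively nonexpansive if there is a sequence $\{k_n\}$ in $[1,\infty)$ with $\lim k_n=1$ and $\|T^nx-T^ny\|\le k_n\|x-y\|$ for all $x\in A$, $y\in B$ and $n\in\mathbb{N}$. *)

theory Defs
  imports "HOL-Analysis.Analysis"
begin

definition weakly_converges :: "(nat \<Rightarrow> 'a::real_normed_vector) \<Rightarrow> 'a \<Rightarrow> bool" where
  "weakly_converges x l \<longleftrightarrow>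
     (\<forall>f :: 'a \<Rightarrow>\<^sub>L real. (\<lambda>n. blinfun_apply f (x n)) \<longlonglongrightarrow> blinfun_apply f l)"

text \<open>Reflexivity is surjectivity of the canonical embedding of the space into its bidual.\<close>

definition reflexive_space :: "'a::real_normed_vector itself \<Rightarrow> bool" where
  "reflexive_space _ \<longleftrightarrow>
     (\<forall>\<phi> :: ('a \<Rightarrow>\<^sub>L real) \<Rightarrow>\<^sub>L real. \<exists>x :: 'a. \<forall>f. blinfun_apply \<phi> f = blinfun_apply f x)"

definition uniformly_Kadec_Klee :: "'a::real_normed_vector itself \<Rightarrow> bool" where
  "uniformly_Kadec_Klee _ \<longleftrightarrow>
     (\<forall>\<epsilon>>0. \<exists>\<delta>>0. \<forall>(x :: nat \<Rightarrow> 'a) x0.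
        (\<forall>n. x n \<in> cball 0 1) \<longrightarrow> weakly_converges x x0 \<longrightarrow>
        Inf {norm (x n - x m) | n m. n \<noteq> m} > \<epsilon> \<longrightarrow> norm x0 \<le> 1 - \<delta>)"

definition nearly_uniformly_convex :: "'a::banach itself \<Rightarrow> bool" where
  "nearly_uniformly_convex X \<longleftrightarrow> reflexive_space X \<and> uniformly_Kadec_Klee X"

definition proximal_pair :: "'a::real_normed_vector set \<Rightarrow> 'a set \<Rightarrow> bool" where
  "proximal_pair A B \<longleftrightarrow>
     (\<forall>(x, y) \<in> A \<times> B. \<exists>(x1, y1) \<in> A \<times> B.
        norm (x - y1) = setdist A B \<and> norm (y - x1) = setdist A B)"

definition sharp_proximal_pair :: "'a::real_normed_vector set \<Rightarrow> 'a set \<Rightarrow> bool" where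
  "sharp_proximal_pair A B \<longleftrightarrow> proximal_pair A B \<and>
     (\<forall>(x, y) \<in> A \<times> B. \<exists>!(x1, y1). (x1, y1) \<in> A \<times> B \<and>
        norm (x - y1) = setdist A B \<and> norm (y - x1) = setdist A B)"

text \<open>
  That \<open>a + h\<close> is the point of \<open>B\<close> proximal to \<open>a\<close>, and hence \<open>\<parallel>h\<parallel> = setdist A B\<close>, is not
  part of the definition: for bounded nonempty \<open>A\<close> it follows. If \<open>p\<close> maps a point of \<open>A\<close> to its
  proximal point in \<open>B\<close> and \<open>q a = p a - h \<in> A\<close>, telescoping along the \<open>q\<close>-orbit of \<open>a\<close> gives
  \<open>\<parallel>(q\<^sup>n a - a) / n + h\<parallel> \<le> setdist A B\<close>, and \<open>n \<rightarrow> \<infinity>\<close> gives \<open>\<parallel>h\<parallel> \<le> setdist A B\<close>.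
\<close>

definition proximal_parallel_pair :: "'a::real_normed_vector set \<Rightarrow> 'a set \<Rightarrow> bool" where
  "proximal_parallel_pair A B \<longleftrightarrow>
     sharp_proximal_pair A B \<and> (\<exists>!h. B = (\<lambda>a. a + h) ` A)"

text \<open>
  Intended for convex proximal parallel pairs, where the translation vector \<open>h\<close> is unique.
\<close>

definition rectangle_property :: "'a::real_normed_vector set \<Rightarrow> 'a set \<Rightarrow> bool" where
  "rectangle_property A B \<longleftrightarrow>
     (\<exists>h. B = (\<lambda>a. a + h) ` A \<and>
        (\<forall>x\<in>A. \<forall>y\<in>A. norm (x + h - y) = norm (y + h - x)))"

definition property_UC :: "'a::real_normed_vector set \<Rightarrow> 'a set \<Rightarrow> bool" where
  "property_UC A B \<longleftrightarrow>
     (\<forall>x z y :: nat \<Rightarrow> 'a.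
        (\<forall>n. x n \<in> A) \<longrightarrow> (\<forall>n. z n \<in> A) \<longrightarrow> (\<forall>n. y n \<in> B) \<longrightarrow>
        (\<lambda>n. norm (x n - y n)) \<longlonglongrightarrow> setdist A B \<longrightarrow>
        (\<lambda>n. norm (z n - y n)) \<longlonglongrightarrow> setdist A B \<longrightarrow>
        (\<lambda>n. norm (x n - z n)) \<longlonglongrightarrow> 0)"

definition asymptotically_relatively_nonexpansive ::
    "'a::real_normed_vector set \<Rightarrow> 'a set \<Rightarrow> ('a \<Rightarrow> 'a) \<Rightarrow> bool" where
  "asymptotically_relatively_nonexpansive A B T \<longleftrightarrow>
     T \<in> A \<union> B \<rightarrow> A \<union> B \<and>
     (\<exists>k :: nat \<Rightarrow> real. (\<forall>n. 1 \<le> k n) \<and> k \<longlonglongrightarrow> 1 \<and>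
        (\<forall>x\<in>A. \<forall>y\<in>B. \<forall>n. norm ((T ^^ n) x - (T ^^ n) y) \<le> k n * norm (x - y)))"

end

theory Submission
  imports Defs
begin

text \<open>
The rectangle property turns the pair into a single set \<open>A\<close> together with the symmetric gauge
\<open>D x y = \<parallel>x - (y + h)\<parallel>\<close>, where \<open>B = A + h\<close>. This gauge is bounded below by
\<open>d = setdist A B = \<parallel>h\<parallel>\<close>, and the property UC says that \<open>D\<close> close to \<open>d\<close> forces the two arguments to
be close in norm. Since \<open>D ((T ^^ m) y) ((T ^^ m) (y + h) - h)\<close> tends to \<open>d\<close>, the orbits of \<open>y\<close> and
of \<open>y + h\<close> run asymptotically parallel, so that asymptotically \<open>T\<close> is nonexpansive for \<open>D\<close> along
orbits in \<open>A\<close>.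

For \<open>x\<close> in \<open>A\<close> put \<open>\<rho>\<^sub>x y = limsup D ((T ^^ n) x) y\<close>. This function is convex and weakly lower
semicontinuous, and it does not increase from \<open>y\<close> to a weak limit of a subsequence of the orbit of
\<open>y\<close>. By Zorn's lemma and weak compactness there is a minimal nonempty closed convex \<open>K \<subseteq> A\<close> that
contains all such weak limits of the orbits of its points; on \<open>K\<close> each \<open>\<rho>\<^sub>x\<close> is then a constant
\<open>\<rho> x\<close> (\<open>constant_asymptotic_radius\<close>).

Let \<open>x \<in> K\<close> and \<open>\<rho> x > d\<close>. If the orbit of \<open>x\<close> were eventually covered by finitely many small balls,
then averaging points of \<open>K\<close> near their centres would give a point of \<open>K\<close> with asymptotic radius
below \<open>\<rho> x\<close> (\<open>covered_orbit_radius_le\<close>). Hence the orbit has a separated subsequence, which may be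
taken weakly convergent to some \<open>z \<in> K\<close>. The uniform Kadec-Klee property bounds
\<open>D z ((T ^^ m) z)\<close> asymptotically by \<open>(1 - \<delta>) * \<rho> x\<close>, and symmetry of \<open>D\<close> gives
\<open>\<rho> z \<le> (1 - \<delta>) * \<rho> x\<close> with \<open>\<delta>\<close> uniform as long as \<open>\<rho> x\<close> stays away from \<open>d\<close>
(\<open>radius_decreases\<close>). Therefore the infimum of \<open>\<rho>\<close> over \<open>K\<close> is \<open>d\<close>. By UC this forces \<open>K\<close> to be a
single point \<open>x\<close>, and the orbit of \<open>x\<close> converges to \<open>x\<close> in norm; then the orbit of \<open>x + h\<close> converges
to \<open>x + h\<close>, and continuity makes both points fixed.

The functional analysis behind this is the weak sequential compactness of bounded closed convex sets
in a reflexive space and the Hahn-Banach separation theorem. Both are proved first.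
\<close>

section \<open>Linear minorants and separation\<close>

definition sublinear :: "('a::real_vector \<Rightarrow> real) \<Rightarrow> bool" where
  "sublinear p \<longleftrightarrow> (\<forall>x y. p (x + y) \<le> p x + p y) \<and> (\<forall>t x. 0 \<le> t \<longrightarrow> p (t *\<^sub>R x) \<le> t * p x)"

lemma sublinear_add: "sublinear p \<Longrightarrow> p (x + y) \<le> p x + p y"
  by (simp add: sublinear_def)

lemma sublinear_scale: "sublinear p \<Longrightarrow> 0 \<le> t \<Longrightarrow> p (t *\<^sub>R x) \<le> t * p x"
  by (simp add: sublinear_def)

lemma sublinear_zero:
  assumes "sublinear p" shows "p 0 = 0"
  using sublinear_add[OF assms, of 0 0] sublinear_scale[OF assms, of 0 0] by simp

lemma sublinear_minus:
  assumes "sublinear p" shows "- p (- x) \<le> p x"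
  using sublinear_add[OF assms, of x "- x"] sublinear_zero[OF assms] by simp

lemma sublinear_norm: "sublinear (norm :: 'a::real_normed_vector \<Rightarrow> real)"
  by (simp add: sublinear_def norm_triangle_ineq)

text \<open>
The functional \<open>q x = Inf {p (x + k) - c | (k, c) \<in> S}\<close> is the largest sublinear minorant of \<open>p\<close>
with the prescribed bounds \<open>q (- k) \<le> - c\<close>. Two cones \<open>S\<close> matter: a single ray, which
shows that minimal sublinear functionals are linear, and the cone over a convex set, which makes
linear functionals separate that set from a point.
\<close>

lemma sublinear_reduction:
  fixes p :: "'a::real_vector \<Rightarrow> real"
  assumes p: "sublinear p" and S0: "(0, 0) \<in> S"
    and S_add: "\<And>k c k' c'. (k, c) \<in> S \<Longrightarrow> (k', c') \<in> S \<Longrightarrow> (k + k', c + c') \<in> S"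
    and S_scale: "\<And>t k c. 0 < t \<Longrightarrow> (k, c) \<in> S \<Longrightarrow> (t *\<^sub>R k, t * c) \<in> S"
    and S_le: "\<And>k c. (k, c) \<in> S \<Longrightarrow> c \<le> p k"
  obtains q where "sublinear q" "\<And>x. q x \<le> p x" "\<And>k c. (k, c) \<in> S \<Longrightarrow> q (- k) \<le> - c"
proof -
  define q where "q = (\<lambda>x. Inf {p (x + k) - c | k c. (k, c) \<in> S})"
  have low: "- p (- x) \<le> p (x + k) - c" if "(k, c) \<in> S" for x k c
    using S_le[OF that] sublinear_add[OF p, of "x + k" "- x"] by simp
  have q_le: "q x \<le> p (x + k) - c" if "(k, c) \<in> S" for x k c
    unfolding q_def by (rule cInf_lower) (use that low[where x = x] in \<open>auto simp: bdd_below_def\<close>)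
  have q_ge: "b \<le> q x" if "\<And>k c. (k, c) \<in> S \<Longrightarrow> b \<le> p (x + k) - c" for x b
    unfolding q_def by (rule cInf_greatest) (use that S0 in auto)
  have "sublinear q"
    unfolding sublinear_def
  proof (intro conjI allI impI)
    fix x y
    have "q (x + y) - q x \<le> q y"
    proof (rule q_ge)
      fix k c assume kc: "(k, c) \<in> S"
      have "q (x + y) - (p (y + k) - c) \<le> q x"
      proof (rule q_ge)
        fix k' c' assume kc': "(k', c') \<in> S"
        show "q (x + y) - (p (y + k) - c) \<le> p (x + k') - c'"
          using q_le[OF S_add[OF kc' kc], of "x + y"] sublinear_add[OF p, of "x + k'" "y + k"]
          by (simp add: algebra_simps)
      qed
      then show "q (x + y) - q x \<le> p (y + k) - c" by simp
    qed
    then show "q (x + y) \<le> q x + q y" by simp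
  next
    fix t :: real and x assume t: "0 \<le> t"
    show "q (t *\<^sub>R x) \<le> t * q x"
    proof (cases "t = 0")
      case True
      then show ?thesis using q_le[OF S0, of 0] sublinear_zero[OF p] by simp
    next
      case False
      with t have t: "0 < t" by simp
      have "q (t *\<^sub>R x) / t \<le> q x"
      proof (rule q_ge)
        fix k c assume kc: "(k, c) \<in> S"
        have "q (t *\<^sub>R x) \<le> t * (p (x + k) - c)"
          using q_le[OF S_scale[OF t kc], of "t *\<^sub>R x"] sublinear_scale[OF p, of t "x + k"] t
          by (simp add: algebra_simps)
        then show "q (t *\<^sub>R x) / t \<le> p (x + k) - c"
          using t by (simp add: divide_le_eq mult.commute)
      qed
      then show ?thesis using t by (simp add: divide_le_eq mult.commute)
    qed
  qed
  moreover have "q x \<le> p x" for x using q_le[OF S0, of x] by simp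
  moreover have "q (- k) \<le> - c" if "(k, c) \<in> S" for k c
    using q_le[OF that, of "- k"] sublinear_zero[OF p] by simp
  ultimately show ?thesis by (rule that)
qed

text \<open>
Reducing \<open>q\<close> along the ray through \<open>a\<close> cannot change a minimal \<open>q\<close>, so \<open>q (- a) \<le> - q a\<close>. An odd
sublinear functional is linear.
\<close>

lemma minimal_sublinear_linear:
  assumes q: "sublinear q" and min: "\<And>r. sublinear r \<Longrightarrow> (\<And>x. r x \<le> q x) \<Longrightarrow> r = q"
  shows "linear q"
proof -
  have neg: "q (- a) = - q a" for a
  proof -
    let ?S = "{(t *\<^sub>R a, t * q a) | t. 0 \<le> t}"
    obtain r where r: "sublinear r" "\<And>x. r x \<le> q x" "\<And>k c. (k, c) \<in> ?S \<Longrightarrow> r (- k) \<le> - c"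
    proof (rule sublinear_reduction[OF q, of ?S])
      show "(0, 0) \<in> ?S" by force
      show "(k + k', c + c') \<in> ?S" if "(k, c) \<in> ?S" "(k', c') \<in> ?S" for k c k' c'
      proof -
        obtain s s' where "k = s *\<^sub>R a" "c = s * q a" "k' = s' *\<^sub>R a" "c' = s' * q a" "0 \<le> s" "0 \<le> s'"
          using \<open>(k, c) \<in> ?S\<close> \<open>(k', c') \<in> ?S\<close> by auto
        then show ?thesis
          by (auto intro!: exI[of _ "s + s'"] simp: algebra_simps)
      qed
      show "(t *\<^sub>R k, t * c) \<in> ?S" if t: "0 < t" and "(k, c) \<in> ?S" for t k c
      proof -
        obtain s where "k = s *\<^sub>R a" "c = s * q a" "0 \<le> s" using \<open>(k, c) \<in> ?S\<close> by auto
        then show ?thesis using t by (auto intro!: exI[of _ "t * s"])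
      qed
      show "c \<le> q k" if "(k, c) \<in> ?S" for k c
      proof -
        obtain s where s: "k = s *\<^sub>R a" "c = s * q a" "0 \<le> s" using \<open>(k, c) \<in> ?S\<close> by auto
        show ?thesis
        proof (cases "s = 0")
          case True then show ?thesis using s sublinear_zero[OF q] by simp
        next
          case False
          then have "q a \<le> (1 / s) * q k"
            using s sublinear_scale[OF q, of "1 / s" k] by simp
          then show ?thesis using s False by (simp add: field_simps)
        qed
      qed
    qed auto
    have "(a, q a) \<in> ?S" by (auto intro!: exI[of _ 1])
    then have "q (- a) \<le> - q a" using r(3) min[OF r(1,2)] by simp
    then show ?thesis using sublinear_minus[OF q, of a] by simp
  qed
  show ?thesis
  proof (rule linearI)
    fix x y
    show "q (x + y) = q x + q y"
      using sublinear_add[OF q, of x y] sublinear_add[OF q, of "- x" "- y"] neg[of x] neg[of y]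
        neg[of "x + y"] by simp
  next
    fix t x
    have pos: "q (s *\<^sub>R x) = s * q x" if "0 \<le> s" for s
      using sublinear_scale[OF q that, of x] sublinear_scale[OF q that, of "- x"]
        neg[of x] neg[of "s *\<^sub>R x"] by simp
    show "q (t *\<^sub>R x) = t *\<^sub>R q x"
      using pos[of t] pos[of "- t"] neg[of "t *\<^sub>R x"] by (cases "0 \<le> t") auto
  qed
qed

lemma sublinear_Inf_chain:
  fixes p :: "'a::real_vector \<Rightarrow> real"
  assumes Q: "Q \<noteq> {}" "\<And>q. q \<in> Q \<Longrightarrow> sublinear q \<and> (\<forall>x. q x \<le> p x)"
    and ch: "\<And>q r. q \<in> Q \<Longrightarrow> r \<in> Q \<Longrightarrow> (\<forall>x. q x \<le> r x) \<or> (\<forall>x. r x \<le> q x)"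
  obtains u where "sublinear u" "\<And>q x. q \<in> Q \<Longrightarrow> u x \<le> q x"
proof -
  define u where "u = (\<lambda>x. INF q\<in>Q. q x)"
  have bdd: "bdd_below ((\<lambda>q. q x) ` Q)" for x
  proof (rule bdd_belowI2)
    fix q assume "q \<in> Q"
    then show "- p (- x) \<le> q x" using Q(2)[of q] sublinear_minus[of q x]
      by (meson neg_le_iff_le order_trans)
  qed
  have le: "u x \<le> q x" if "q \<in> Q" for q x
    unfolding u_def by (rule cINF_lower[OF bdd that])
  have ge: "b \<le> u x" if "\<And>q. q \<in> Q \<Longrightarrow> b \<le> q x" for b x
    unfolding u_def by (rule cINF_greatest[OF Q(1) that])
  have "sublinear u"
    unfolding sublinear_def
  proof (intro conjI allI impI)
    fix x y
    have "u (x + y) - u x \<le> u y"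
    proof (rule ge)
      fix q assume q: "q \<in> Q"
      have "u (x + y) - q y \<le> u x"
      proof (rule ge)
        fix r assume r: "r \<in> Q"
        \<comment> \<open>the smaller of the two members of the chain controls both summands\<close>
        obtain s where s: "s \<in> Q" "s x \<le> r x" "s y \<le> q y"
          using ch[OF q r] q r by blast
        show "u (x + y) - q y \<le> r x"
          using le[OF s(1), of "x + y"] s sublinear_add[of s x y] Q(2)[OF s(1)] by fastforce
      qed
      then show "u (x + y) - u x \<le> q y" by simp
    qed
    then show "u (x + y) \<le> u x + u y" by simp
  next
    fix t :: real and x assume t: "0 \<le> t"
    show "u (t *\<^sub>R x) \<le> t * u x"
    proof (cases "t = 0")
      case True
      obtain q where q: "q \<in> Q" using Q by blast
      then show ?thesis using True le[OF q, of 0] sublinear_zero[of q] Q(2)[OF q] by simp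
    next
      case False
      with t have t: "0 < t" by simp
      have "u (t *\<^sub>R x) / t \<le> u x"
      proof (rule ge)
        fix q assume q: "q \<in> Q"
        have "u (t *\<^sub>R x) \<le> t * q x"
          using le[OF q, of "t *\<^sub>R x"] sublinear_scale[of q t x] Q(2)[OF q] t by linarith
        then show "u (t *\<^sub>R x) / t \<le> q x" using t by (simp add: divide_le_eq mult.commute)
      qed
      then show ?thesis using t by (simp add: divide_le_eq mult.commute)
    qed
  qed
  then show ?thesis using le by (rule that)
qed

text \<open>
The Hahn-Banach theorem: Zorn's lemma yields a minimal sublinear functional below \<open>p\<close>.
\<close>

lemma linear_minorant:
  fixes p :: "'a::real_vector \<Rightarrow> real"
  assumes p: "sublinear p"
  obtains f where "linear f" "\<And>x. f x \<le> p x"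
proof -
  define Q where "Q = {q. sublinear q \<and> (\<forall>x. q x \<le> p x)}"
  let ?P = "\<lambda>q r :: 'a \<Rightarrow> real. \<forall>x. r x \<le> q x"
  have "\<exists>m\<in>Q. \<forall>a\<in>Q. ?P m a \<longrightarrow> a = m"
  proof (rule predicate_Zorn)
    show "partial_order_on Q (relation_of ?P Q)"
      by (rule partial_order_on_relation_ofI) (auto intro: order_trans order_antisym simp: fun_eq_iff)
  next
    fix C assume C: "C \<in> Chains (relation_of ?P Q)"
    then have sub: "C \<subseteq> Q" and ch: "\<And>q r. q \<in> C \<Longrightarrow> r \<in> C \<Longrightarrow> ?P q r \<or> ?P r q"
      by (auto simp: Chains_def relation_of_def)
    show "\<exists>u\<in>Q. \<forall>a\<in>C. ?P a u"
    proof (cases "C = {}")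
      case True
      then show ?thesis using p by (auto simp: Q_def)
    next
      case False
      obtain u where u: "sublinear u" "\<And>q x. q \<in> C \<Longrightarrow> u x \<le> q x"
        using sublinear_Inf_chain[OF False, of p] sub ch unfolding Q_def by blast
      obtain q where "q \<in> C" using False by blast
      then have "u x \<le> p x" for x
        using u(2)[of q x] sub by (auto simp: Q_def intro: order_trans)
      then have "u \<in> Q" using u(1) by (simp add: Q_def)
      then show ?thesis using u(2) by blast
    qed
  qed
  then obtain m where m: "m \<in> Q" "\<And>r. r \<in> Q \<Longrightarrow> \<forall>x. r x \<le> m x \<Longrightarrow> r = m" by blast
  have "linear m"
  proof (rule minimal_sublinear_linear)
    show "sublinear m" using m(1) by (simp add: Q_def)
    show "r = m" if "sublinear r" "\<And>x. r x \<le> m x" for r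
    proof (rule m(2))
      show "r \<in> Q" using that m(1) by (auto simp: Q_def intro: order_trans)
    qed (use that in blast)
  qed
  then show ?thesis using m(1) that by (auto simp: Q_def)
qed

text \<open>
The functional is a linear minorant of \<open>x \<mapsto> Inf {\<parallel>x + t (c - y)\<parallel> - t r | t \<ge> 0, c \<in> C}\<close>. This is
finite because \<open>C\<close> has distance at least \<open>r\<close> from \<open>y\<close>, and sublinear because \<open>C\<close> is convex.
\<close>

lemma separation_with_gap:
  fixes C :: "'a::real_normed_vector set"
  assumes "convex C" "C \<noteq> {}" "0 \<le> r" and gap: "\<And>c. c \<in> C \<Longrightarrow> r \<le> norm (c - y)"
  obtains f :: "'a \<Rightarrow>\<^sub>L real" where "norm f \<le> 1" "\<And>c. c \<in> C \<Longrightarrow> blinfun_apply f y + r \<le> blinfun_apply f c"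
proof -
  let ?S = "{(t *\<^sub>R (c - y), t * r) | t c. 0 \<le> t \<and> c \<in> C}"
  obtain q where q: "sublinear q" "\<And>x. q x \<le> norm x" "\<And>k c. (k, c) \<in> ?S \<Longrightarrow> q (- k) \<le> - c"
  proof (rule sublinear_reduction[OF sublinear_norm, of ?S])
    show "(0, 0) \<in> ?S" using \<open>C \<noteq> {}\<close> by force
    show "(k + k', u + u') \<in> ?S" if "(k, u) \<in> ?S" "(k', u') \<in> ?S" for k u k' u'
    proof -
      obtain t c t' c' where *: "k = t *\<^sub>R (c - y)" "u = t * r" "0 \<le> t" "c \<in> C"
          "k' = t' *\<^sub>R (c' - y)" "u' = t' * r" "0 \<le> t'" "c' \<in> C"
        using \<open>(k, u) \<in> ?S\<close> \<open>(k', u') \<in> ?S\<close> by auto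
      show ?thesis
      proof (cases "t + t' = 0")
        case True
        then have "t = 0" "t' = 0" using * by auto
        then have "(k + k', u + u') = (0 *\<^sub>R (c - y), 0 * r)" using * by simp
        then show ?thesis using \<open>c \<in> C\<close>
          by (intro CollectI exI[of _ "0::real"] exI[of _ c] conjI) auto
      next
        case False
        then have pos: "0 < t + t'" using * by auto
        let ?c = "(t / (t + t')) *\<^sub>R c + (t' / (t + t')) *\<^sub>R c'"
        have "?c \<in> C"
          using \<open>convex C\<close> * pos by (intro convexD) (auto simp: add_divide_distrib[symmetric])
        moreover have "k + k' = (t + t') *\<^sub>R (?c - y)"
        proof -
          have "(t + t') *\<^sub>R ?c = t *\<^sub>R c + t' *\<^sub>R c'"
            using pos by (simp add: scaleR_right_distrib)
          then show ?thesis
            by (simp only: scaleR_right_diff_distrib) (simp add: * algebra_simps)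
        qed
        moreover have "u + u' = (t + t') * r" by (simp add: * algebra_simps)
        moreover have "0 \<le> t + t'" using pos by simp
        ultimately show ?thesis
          by (intro CollectI exI[of _ "t + t'"] exI[of _ ?c] conjI) auto
      qed
    qed
    show "(t *\<^sub>R k, t * u) \<in> ?S" if t: "0 < t" and "(k, u) \<in> ?S" for t k u
    proof -
      obtain s c where "k = s *\<^sub>R (c - y)" "u = s * r" "0 \<le> s" "c \<in> C" using \<open>(k, u) \<in> ?S\<close> by auto
      then show ?thesis using t by (auto intro!: exI[of _ "t * s"])
    qed
    show "u \<le> norm k" if "(k, u) \<in> ?S" for k u
      using that gap by (auto intro!: mult_left_mono)
  qed auto
  obtain g where g: "linear g" "\<And>x. g x \<le> q x" using linear_minorant[OF q(1)] by blast
  have g_norm: "\<bar>g x\<bar> \<le> norm x" for x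
    using g(2)[of x] g(2)[of "- x"] q(2)[of x] q(2)[of "- x"] linear_neg[OF g(1), of x] by simp
  then have bl: "bounded_linear g"
    using g(1) by (intro bounded_linear_intro[where K = 1]) (auto simp: linear_add linear_scale)
  show ?thesis
  proof (rule that[of "Blinfun g"])
    show "norm (Blinfun g) \<le> 1"
      by (rule norm_blinfun_bound) (auto simp: bounded_linear_Blinfun_apply[OF bl] g_norm)
    fix c assume "c \<in> C"
    then have "(c - y, r) \<in> ?S" by (auto intro!: exI[of _ 1])
    then have "g (- (c - y)) \<le> - r" using g(2)[of "- (c - y)"] q(3)[of "c - y" r] by linarith
    then show "blinfun_apply (Blinfun g) y + r \<le> blinfun_apply (Blinfun g) c"
      using linear_neg[OF g(1), of "c - y"] linear_diff[OF g(1), of c y]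
      by (simp add: bounded_linear_Blinfun_apply[OF bl])
  qed
qed

lemma closed_convex_separation:
  fixes C :: "'a::real_normed_vector set"
  assumes "closed C" "convex C" "y \<notin> C"
  obtains f :: "'a \<Rightarrow>\<^sub>L real" and a where "blinfun_apply f y < a" "\<And>c. c \<in> C \<Longrightarrow> a \<le> blinfun_apply f c"
proof (cases "C = {}")
  case True
  then show ?thesis by (intro that[of 0 1]) auto
next
  case False
  have "y \<in> - C" "open (- C)" using assms by auto
  then obtain r where r: "0 < r" "ball y r \<subseteq> - C" by (meson open_contains_ball)
  have "r \<le> norm (c - y)" if "c \<in> C" for c
    using r that by (force simp: dist_norm norm_minus_commute)
  then obtain f :: "'a \<Rightarrow>\<^sub>L real" where "\<And>c. c \<in> C \<Longrightarrow> blinfun_apply f y + r \<le> blinfun_apply f c"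
    using separation_with_gap[OF \<open>convex C\<close> False, of r y] r(1) by (metis less_imp_le)
  then show ?thesis using r(1) by (intro that[of f "blinfun_apply f y + r"]) auto
qed

lemma norming_functional:
  fixes x :: "'a::real_normed_vector"
  obtains f :: "'a \<Rightarrow>\<^sub>L real" where "norm f \<le> 1" "norm x \<le> blinfun_apply f x"
  using separation_with_gap[of "{x}" "norm x" 0] by (auto simp: blinfun.zero_right)

lemma functionals_separate_points:
  fixes x y :: "'a::real_normed_vector"
  assumes "\<And>f :: 'a \<Rightarrow>\<^sub>L real. blinfun_apply f x = blinfun_apply f y"
  shows "x = y"
proof -
  obtain f :: "'a \<Rightarrow>\<^sub>L real" where "norm (x - y) \<le> blinfun_apply f (x - y)"
    using norming_functional .
  then show ?thesis using assms[of f] by (simp add: blinfun.diff_right)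
qed

section \<open>Weak compactness in reflexive spaces\<close>

text \<open>
The canonical embedding into the bidual, but with values in the full function space, where the
product topology induces the weak topology.
\<close>

definition evaluation :: "'a::real_normed_vector \<Rightarrow> ('a \<Rightarrow>\<^sub>L real) \<Rightarrow> real" where
  "evaluation x = (\<lambda>f. blinfun_apply f x)"

text \<open>
By Tychonoff's theorem the functions bounded by \<open>M * norm f\<close> form a compact set. Reflexivity
identifies the linear ones among them with points of the space, and by separation membership in
\<open>C\<close> is expressed by closed conditions on single coordinates.
\<close>

lemma compact_evaluation_image:
  fixes C :: "'a::real_normed_vector set"
  assumes "reflexive_space TYPE('a)" "bounded C" "closed C" "convex C"
  shows "compact (evaluation ` C)" "closed (evaluation ` C)"
proof -
  obtain M where M: "0 < M" "\<And>x. x \<in> C \<Longrightarrow> norm x \<le> M"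
    using \<open>bounded C\<close> bounded_pos by blast
  define P where "P = PiE UNIV (\<lambda>f :: 'a \<Rightarrow>\<^sub>L real. cball (0::real) (M * norm f))"
  have P_iff: "g \<in> P \<longleftrightarrow> (\<forall>f. \<bar>g f\<bar> \<le> M * norm f)" for g
    by (auto simp: P_def PiE_iff)
  have "compactin (product_topology (\<lambda>_. euclidean) UNIV) P"
    unfolding P_def compactin_PiE by simp
  then have "compact P"
    by (simp add: euclidean_product_topology flip: compactin_euclidean_iff)
  have P_Inter: "P = (\<Inter>f. {g. \<bar>g f\<bar> \<le> M * norm f})"
    by (auto simp: P_iff)
  have "closed P"
    unfolding P_Inter
    by (intro closed_INT ballI closed_Collect_le continuous_intros)
       (rule continuous_on_product_coordinates)
  define L where "L = (\<Inter>f. \<Inter>f'. {g :: ('a \<Rightarrow>\<^sub>L real) \<Rightarrow> real. g (f + f') = g f + g f'})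
      \<inter> (\<Inter>t. \<Inter>f. {g. g (t *\<^sub>R f) = t * g f})"
  have "closed L"
    unfolding L_def
    by (intro closed_Int closed_INT ballI closed_Collect_eq continuous_on_add continuous_on_mult_left
        continuous_on_product_coordinates)
  define H where "H = (\<Inter>(f, a)\<in>{(f :: 'a \<Rightarrow>\<^sub>L real, a). \<forall>c\<in>C. a \<le> blinfun_apply f c}. {g. a \<le> g f})"
  have "closed H"
    unfolding H_def
    by (intro closed_INT ballI)
       (auto intro!: closed_Collect_le continuous_on_const continuous_on_product_coordinates)
  have "evaluation ` C = P \<inter> (L \<inter> H)"
  proof (intro equalityI subsetI)
    fix g assume "g \<in> evaluation ` C"
    then obtain x where x: "x \<in> C" "g = evaluation x" by blast
    have "\<bar>blinfun_apply f x\<bar> \<le> M * norm f" for f :: "'a \<Rightarrow>\<^sub>L real"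
    proof -
      have "\<bar>blinfun_apply f x\<bar> \<le> norm f * norm x" using norm_blinfun[of f x] by simp
      also have "\<dots> \<le> norm f * M" by (intro mult_left_mono M x) simp
      finally show ?thesis by (simp add: mult.commute)
    qed
    then show "g \<in> P \<inter> (L \<inter> H)"
      using x by (auto simp: P_iff L_def H_def evaluation_def blinfun.add_left blinfun.scaleR_left)
  next
    fix g assume g: "g \<in> P \<inter> (L \<inter> H)"
    have "bounded_linear g"
      using g by (intro bounded_linear_intro[where K = M]) (auto simp: L_def P_iff mult.commute)
    then obtain x :: 'a where x: "\<And>f. g f = blinfun_apply f x"
      using assms(1) bounded_linear_Blinfun_apply[of g] unfolding reflexive_space_def by metis
    have "x \<in> C"
    proof (rule ccontr)
      assume "x \<notin> C"
      then obtain f :: "'a \<Rightarrow>\<^sub>L real" and a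
        where fa: "blinfun_apply f x < a" "\<And>c. c \<in> C \<Longrightarrow> a \<le> blinfun_apply f c"
        using closed_convex_separation[OF \<open>closed C\<close> \<open>convex C\<close>] by metis
      then have "a \<le> g f" using g by (auto simp: H_def)
      then show False using fa x by simp
    qed
    then show "g \<in> evaluation ` C" using x by (auto simp: evaluation_def fun_eq_iff)
  qed
  then show "compact (evaluation ` C)" "closed (evaluation ` C)"
    using \<open>compact P\<close> \<open>closed P\<close> \<open>closed L\<close> \<open>closed H\<close>
    by (auto intro!: compact_Int_closed closed_Int)
qed

lemma reflexive_chain_Inter_nonempty:
  fixes \<C> :: "'a::real_normed_vector set set"
  assumes "reflexive_space TYPE('a)" "\<C> \<noteq> {}"
    and mem: "\<And>C. C \<in> \<C> \<Longrightarrow> C \<noteq> {} \<and> bounded C \<and> closed C \<and> convex C"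
    and chain: "\<And>C D. C \<in> \<C> \<Longrightarrow> D \<in> \<C> \<Longrightarrow> C \<subseteq> D \<or> D \<subseteq> C"
  shows "\<Inter>\<C> \<noteq> {}"
proof -
  obtain C0 where C0: "C0 \<in> \<C>" using \<open>\<C> \<noteq> {}\<close> by blast
  have "evaluation ` C0 \<inter> (\<Inter>C\<in>\<C>. evaluation ` C) \<noteq> {}"
  proof (rule compact_imp_fip_image)
    show "compact (evaluation ` C0)"
      using compact_evaluation_image assms(1) mem[OF C0] by blast
    show "closed (evaluation ` C)" if "C \<in> \<C>" for C
      using compact_evaluation_image assms(1) mem[OF that] by blast
    fix I assume I: "finite I" "I \<subseteq> \<C>"
    have "subset.chain \<C> (insert C0 I)"
      using I C0 chain by (auto simp: subset_chain_def)
    then have "\<Inter>(insert C0 I) \<in> insert C0 I"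
      using Inter_in_chain[OF _ _ \<open>subset.chain \<C> (insert C0 I)\<close>] I(1) by simp
    moreover have "insert C0 I \<subseteq> \<C>" using I C0 by simp
    ultimately have "\<Inter>(insert C0 I) \<in> \<C>" by (rule set_mp[rotated])
    then have "\<Inter>(insert C0 I) \<noteq> {}" using mem by simp
    then show "evaluation ` C0 \<inter> (\<Inter>C\<in>I. evaluation ` C) \<noteq> {}" by blast
  qed
  then obtain a where a: "a \<in> C0" "\<And>C. C \<in> \<C> \<Longrightarrow> evaluation a \<in> evaluation ` C" by blast
  have "a \<in> C" if C: "C \<in> \<C>" for C
  proof -
    obtain c where c: "c \<in> C" "evaluation a = evaluation c" using a(2)[OF C] by blast
    have "a = c"
      by (rule functionals_separate_points) (use fun_cong[OF c(2)] in \<open>simp add: evaluation_def\<close>)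
    then show ?thesis using c by simp
  qed
  then show ?thesis by blast
qed

lemma closed_halfspace_functional:
  fixes f :: "'a::real_normed_vector \<Rightarrow>\<^sub>L real"
  shows "closed {x. blinfun_apply f x \<le> a}" "convex {x. blinfun_apply f x \<le> a}"
proof -
  show "closed {x. blinfun_apply f x \<le> a}"
    by (intro closed_Collect_le continuous_intros)
  have "{x. blinfun_apply f x \<le> a} = blinfun_apply f -` {..a}" by auto
  then show "convex {x. blinfun_apply f x \<le> a}"
    using convex_linear_vimage[of "blinfun_apply f" "{..a}"]
    by (simp add: blinfun.bounded_linear_right bounded_linear.linear)
qed

text \<open>
The point lies in all the closed convex hulls of the tails of the sequence; these form a chain.
\<close>

lemma weak_cluster_point:
  fixes y :: "nat \<Rightarrow> 'a::real_normed_vector"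
  assumes "reflexive_space TYPE('a)" "bounded C" "closed C" "convex C" "\<And>n. y n \<in> C"
  obtains p where "p \<in> C"
    "\<And>(f :: 'a \<Rightarrow>\<^sub>L real) a. (\<forall>\<^sub>F n in sequentially. blinfun_apply f (y n) \<le> a) \<Longrightarrow> blinfun_apply f p \<le> a"
proof -
  define H where "H N = closure (convex hull (y ` {N..}))" for N
  have H_C: "H N \<subseteq> C" for N
    unfolding H_def using assms by (intro closure_minimal hull_minimal) auto
  have H_mono: "H N \<subseteq> H M" if "M \<le> N" for M N
    unfolding H_def using that by (intro closure_mono hull_mono image_mono) auto
  have "\<Inter>(range H) \<noteq> {}"
  proof (rule reflexive_chain_Inter_nonempty[OF assms(1)])
    show "D \<noteq> {} \<and> bounded D \<and> closed D \<and> convex D" if "D \<in> range H" for D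
      using that H_C bounded_subset[OF \<open>bounded C\<close>] by (auto simp: H_def intro: convex_closure)
    show "D \<subseteq> E \<or> E \<subseteq> D" if DE: "D \<in> range H" "E \<in> range H" for D E
    proof -
      obtain M N where "D = H M" "E = H N" using DE by blast
      then show ?thesis using H_mono[of M N] H_mono[of N M] by (cases "M \<le> N") auto
    qed
  qed simp
  then obtain p where p: "\<And>N. p \<in> H N" by blast
  show ?thesis
  proof (rule that)
    show "p \<in> C" using p[of 0] H_C by blast
    fix f :: "'a \<Rightarrow>\<^sub>L real" and a
    assume "\<forall>\<^sub>F n in sequentially. blinfun_apply f (y n) \<le> a"
    then obtain N where N: "\<And>n. N \<le> n \<Longrightarrow> blinfun_apply f (y n) \<le> a"
      by (auto simp: eventually_sequentially)
    have "H N \<subseteq> {x. blinfun_apply f x \<le> a}"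
      unfolding H_def using N
      by (intro closure_minimal hull_minimal closed_halfspace_functional) auto
    then show "blinfun_apply f p \<le> a" using p[of N] by blast
  qed
qed

lemma weak_cluster_point_limit:
  fixes y :: "nat \<Rightarrow> 'a::real_normed_vector" and f :: "'a \<Rightarrow>\<^sub>L real"
  assumes p: "\<And>(f :: 'a \<Rightarrow>\<^sub>L real) a. (\<forall>\<^sub>F n in sequentially. blinfun_apply f (y n) \<le> a) \<Longrightarrow> blinfun_apply f p \<le> a"
    and lim: "(\<lambda>n. blinfun_apply f (y n)) \<longlonglongrightarrow> l"
  shows "blinfun_apply f p = l"
proof (rule order.antisym)
  show "blinfun_apply f p \<le> l"
  proof (rule field_le_epsilon)
    fix e :: real assume "0 < e"
    then have "\<forall>\<^sub>F n in sequentially. blinfun_apply f (y n) < l + e"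
      using order_tendstoD(2)[OF lim] by simp
    then show "blinfun_apply f p \<le> l + e"
      by (intro p) (auto elim: eventually_mono)
  qed
  show "l \<le> blinfun_apply f p"
  proof (rule field_le_epsilon)
    fix e :: real assume "0 < e"
    then have "\<forall>\<^sub>F n in sequentially. l - e < blinfun_apply f (y n)"
      using order_tendstoD(1)[OF lim] by simp
    then have "blinfun_apply (- f) p \<le> - (l - e)"
      by (intro p) (auto elim!: eventually_mono simp: blinfun.minus_left)
    then show "l \<le> blinfun_apply f p + e" by (simp add: blinfun.minus_left)
  qed
qed

text \<open>
Lists make the countability of the set of rational combinations and its closure under addition
immediate.
\<close>

definition rational_combination :: "(nat \<Rightarrow> 'a::real_vector) \<Rightarrow> (nat \<times> rat) list \<Rightarrow> 'a" where
  "rational_combination x l = (\<Sum>(i, q)\<leftarrow>l. of_rat q *\<^sub>R x i)"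

lemma rational_combination_closure:
  fixes x :: "nat \<Rightarrow> 'a::real_normed_vector"
  defines "Y \<equiv> closure (range (rational_combination x))"
  shows "subspace Y" "x n \<in> Y"
proof -
  let ?D = "range (rational_combination x)"
  have D_add: "a + b \<in> ?D" if ab: "a \<in> ?D" "b \<in> ?D" for a b
  proof -
    obtain l l' where "a = rational_combination x l" "b = rational_combination x l'" using ab by blast
    then have "a + b = rational_combination x (l @ l')" by (simp add: rational_combination_def)
    then show ?thesis by blast
  qed
  have D_scale: "of_rat r *\<^sub>R a \<in> ?D" if a: "a \<in> ?D" for a r
  proof -
    obtain l where l: "a = rational_combination x l" using a by blast
    have "of_rat r *\<^sub>R rational_combination x l = rational_combination x (map (\<lambda>(i, q). (i, r * q)) l)"
      by (induction l) (auto simp: rational_combination_def scaleR_right_distrib of_rat_mult)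
    then show ?thesis using l by blast
  qed
  show "subspace Y"
    unfolding subspace_def
  proof (intro conjI ballI allI)
    have "0 = rational_combination x []" by (simp add: rational_combination_def)
    then show "0 \<in> Y" unfolding Y_def using closure_subset[of ?D] by blast
  next
    fix a b assume "a \<in> Y" "b \<in> Y"
    then obtain u v where uv: "\<And>n. u n \<in> ?D" "u \<longlonglongrightarrow> a" "\<And>n. v n \<in> ?D" "v \<longlonglongrightarrow> b"
      unfolding Y_def closure_sequential by blast
    then show "a + b \<in> Y"
      unfolding Y_def closure_sequential
      by (intro exI[of _ "\<lambda>n. u n + v n"]) (auto intro: tendsto_add D_add)
  next
    fix t :: real and a assume "a \<in> Y"
    then obtain u where u: "\<And>n. u n \<in> ?D" "u \<longlonglongrightarrow> a"
      unfolding Y_def closure_sequential by blast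
    have "t \<in> closure \<rat>" by (simp add: Rats_closure_real)
    then obtain s where s: "\<And>n. s n \<in> \<rat>" "s \<longlonglongrightarrow> t" unfolding closure_sequential by blast
    have "s n *\<^sub>R u n \<in> ?D" for n
      using s(1)[of n] u(1)[of n] D_scale by (auto elim!: Rats_cases)
    then show "t *\<^sub>R a \<in> Y"
      unfolding Y_def closure_sequential
      by (intro exI[of _ "\<lambda>n. s n *\<^sub>R u n"]) (simp add: tendsto_scaleR s u)
  qed
  have "x n = rational_combination x [(n, 1)]" by (simp add: rational_combination_def)
  then show "x n \<in> Y" unfolding Y_def using closure_subset[of ?D] by blast
qed

text \<open>
Take functionals norming the countably many rational combinations of the \<open>x n\<close>. If all of them
vanish at \<open>y\<close>, then every rational combination \<open>d\<close> satisfies \<open>\<parallel>d\<parallel> \<le> \<parallel>d - y\<parallel>\<close>, and \<open>y\<close> is a limit of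
such \<open>d\<close>.
\<close>

lemma countable_separating_functionals:
  fixes x :: "nat \<Rightarrow> 'a::real_normed_vector"
  obtains Y and F :: "nat \<Rightarrow> 'a \<Rightarrow>\<^sub>L real" where "closed Y" "subspace Y" "\<And>n. x n \<in> Y"
    "\<And>i. norm (F i) \<le> 1"
    "\<And>y. y \<in> Y \<Longrightarrow> (\<And>i. blinfun_apply (F i) y = 0) \<Longrightarrow> y = 0"
proof -
  define D where "D = range (rational_combination x)"
  have "\<exists>f :: 'a \<Rightarrow>\<^sub>L real. norm f \<le> 1 \<and> norm d \<le> blinfun_apply f d" for d
    using norming_functional[of d] by blast
  then obtain G :: "'a \<Rightarrow> 'a \<Rightarrow>\<^sub>L real"
    where G: "\<And>d. norm (G d) \<le> 1" "\<And>d. norm d \<le> blinfun_apply (G d) d" by metis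
  define F where "F i = G (rational_combination x (from_nat i))" for i
  show ?thesis
  proof (rule that[of "closure D" F])
    show "closed (closure D)" "subspace (closure D)" "\<And>n. x n \<in> closure D"
      unfolding D_def using rational_combination_closure by auto
    show "norm (F i) \<le> 1" for i by (simp add: F_def G)
    fix y assume y: "y \<in> closure D" and F0: "\<And>i. blinfun_apply (F i) y = 0"
    have small: "norm y \<le> 2 * e" if e: "0 < e" for e
    proof -
      obtain d where d: "d \<in> D" "norm (d - y) < e"
        using y e unfolding closure_approachable dist_norm by blast
      obtain l where l: "d = rational_combination x l" using d(1) by (auto simp: D_def)
      then have "F (to_nat l) = G d" by (simp add: F_def)
      then have "norm d \<le> blinfun_apply (G d) (d - y)"
        using G(2)[of d] F0[of "to_nat l"] by (simp add: blinfun.diff_right)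
      also have "\<dots> \<le> norm (G d) * norm (d - y)"
        using norm_blinfun[of "G d" "d - y"] by simp
      also have "\<dots> \<le> norm (d - y)" using G(1)[of d] by (simp add: mult_left_le_one_le)
      finally have "norm y \<le> 2 * norm (d - y)"
        using norm_triangle_ineq4[of d "d - y"] by simp
      then show ?thesis using d(2) by simp
    qed
    have "norm y \<le> e" if "0 < e" for e using small[of "e / 2"] that by simp
    then have "norm y \<le> 0" using field_le_epsilon[of "norm y" 0] by simp
    then show "y = 0" by simp
  qed
qed

text \<open>
A countable product of compact intervals is compact and metrizable, hence sequentially compact.
\<close>

lemma diagonal_subsequence_coordinates:
  fixes u :: "nat \<Rightarrow> nat \<Rightarrow> real"
  assumes "\<And>k i. \<bar>u k i\<bar> \<le> M"
  obtains r :: "nat \<Rightarrow> nat" and l where "strict_mono r" "\<And>i. (\<lambda>k. u (r k) i) \<longlonglongrightarrow> l i"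
proof -
  have "compactin (product_topology (\<lambda>_. euclidean) UNIV) (PiE (UNIV :: nat set) (\<lambda>_. cball (0::real) M))"
    unfolding compactin_PiE by simp
  then have "compact (PiE (UNIV :: nat set) (\<lambda>_. cball (0::real) M))"
    by (simp add: euclidean_product_topology flip: compactin_euclidean_iff)
  then have "seq_compact (PiE (UNIV :: nat set) (\<lambda>_. cball (0::real) M))"
    by (rule compact_imp_seq_compact)
  then obtain l r where r: "strict_mono (r :: nat \<Rightarrow> nat)" "(u \<circ> r) \<longlonglongrightarrow> l"
    using assms by (elim seq_compactE[of _ u]) (auto simp: PiE_iff)
  have "(\<lambda>k. u (r k) i) \<longlonglongrightarrow> l i" for i
    using continuous_on_tendsto_compose[OF continuous_on_product_coordinates[where i = i] r(2)]
    by (simp add: o_def)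
  then show ?thesis using r(1) that by blast
qed

text \<open>
Pass to a subsequence along which countably many functionals converge that separate the points of
the closed linear span of the sequence. Then all weak cluster points of further subsequences
coincide, so the subsequence converges weakly.
\<close>

theorem reflexive_weakly_sequentially_compact:
  fixes x :: "nat \<Rightarrow> 'a::real_normed_vector"
  assumes refl: "reflexive_space TYPE('a)" and C: "bounded C" "closed C" "convex C" and x: "\<And>n. x n \<in> C"
  obtains r p where "strict_mono r" "p \<in> C" "weakly_converges (\<lambda>n. x (r n)) p"
proof -
  obtain Y and F :: "nat \<Rightarrow> 'a \<Rightarrow>\<^sub>L real" where Y: "closed Y" "subspace Y" "\<And>n. x n \<in> Y"
    and F: "\<And>i. norm (F i) \<le> 1" "\<And>y. y \<in> Y \<Longrightarrow> (\<And>i. blinfun_apply (F i) y = 0) \<Longrightarrow> y = 0"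
    using countable_separating_functionals[of x] by blast
  obtain M where M: "\<And>c. c \<in> C \<Longrightarrow> norm c \<le> M" using C(1) bounded_iff by blast
  have "\<bar>blinfun_apply (F i) (x k)\<bar> \<le> M" for k i
  proof -
    have "\<bar>blinfun_apply (F i) (x k)\<bar> \<le> norm (F i) * norm (x k)"
      using norm_blinfun[of "F i" "x k"] by simp
    also have "\<dots> \<le> 1 * M" using F(1) M[OF x] by (intro mult_mono) auto
    finally show ?thesis by simp
  qed
  then obtain r l where r: "strict_mono (r :: nat \<Rightarrow> nat)"
    and l: "\<And>i. (\<lambda>k. blinfun_apply (F i) (x (r k))) \<longlonglongrightarrow> l i"
    using diagonal_subsequence_coordinates[of "\<lambda>k i. blinfun_apply (F i) (x k)"] by metis
  have CY: "bounded (C \<inter> Y)" "closed (C \<inter> Y)" "convex (C \<inter> Y)"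
    using C Y by (auto intro: bounded_Int convex_Int subspace_imp_convex)
  have cluster: "\<exists>p\<in>C \<inter> Y. (\<forall>i. blinfun_apply (F i) p = l i) \<and>
      (\<forall>(f :: 'a \<Rightarrow>\<^sub>L real) a. (\<forall>\<^sub>F n in sequentially. blinfun_apply f (x (r (s n))) \<le> a) \<longrightarrow> blinfun_apply f p \<le> a)"
    if s: "strict_mono s" for s :: "nat \<Rightarrow> nat"
  proof -
    obtain p where p: "p \<in> C \<inter> Y"
      "\<And>(f :: 'a \<Rightarrow>\<^sub>L real) a. (\<forall>\<^sub>F n in sequentially. blinfun_apply f (x (r (s n))) \<le> a) \<Longrightarrow> blinfun_apply f p \<le> a"
      using weak_cluster_point[OF refl CY, of "\<lambda>n. x (r (s n))"] x Y(3) by blast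
    have "blinfun_apply (F i) p = l i" for i
      by (rule weak_cluster_point_limit[of "\<lambda>n. x (r (s n))"])
        (use p(2) LIMSEQ_subseq_LIMSEQ[OF l[of i] s] in \<open>auto simp: o_def\<close>)
    then show ?thesis using p by (intro bexI[of _ p] conjI allI impI) simp_all
  qed
  obtain p where p: "p \<in> C \<inter> Y" "\<And>i. blinfun_apply (F i) p = l i"
    using cluster[of id] by (auto simp: strict_mono_def)
  \<comment> \<open>a failure of the upper bound along some functional would give a second cluster point\<close>
  have upper: "\<forall>\<^sub>F n in sequentially. blinfun_apply f (x (r n)) < blinfun_apply f p + e"
    if "0 < e" for f :: "'a \<Rightarrow>\<^sub>L real" and e
  proof (rule ccontr)
    assume "\<not> ?thesis"
    then have "\<exists>\<^sub>\<infinity>n. n \<in> {n. blinfun_apply f p + e \<le> blinfun_apply f (x (r n))}"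
      by (simp add: not_eventually INFM_iff_infinite[symmetric] cofinite_eq_sequentially not_less)
    then have inf: "infinite {n. blinfun_apply f p + e \<le> blinfun_apply f (x (r n))}"
      by (simp add: INFM_iff_infinite)
    define s where "s = enumerate {n. blinfun_apply f p + e \<le> blinfun_apply f (x (r n))}"
    have s: "strict_mono s" unfolding s_def by (rule strict_mono_enumerate[OF inf])
    have s_ge: "blinfun_apply f p + e \<le> blinfun_apply f (x (r (s n)))" for n
      using enumerate_in_set[OF inf, of n] by (simp add: s_def)
    obtain q where q: "q \<in> C \<inter> Y" "\<And>i. blinfun_apply (F i) q = l i"
      "\<And>(f :: 'a \<Rightarrow>\<^sub>L real) a. (\<forall>\<^sub>F n in sequentially. blinfun_apply f (x (r (s n))) \<le> a) \<Longrightarrow> blinfun_apply f q \<le> a"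
      using cluster[OF s] by blast
    have "q - p = 0"
      using p q by (intro F(2)) (auto simp: blinfun.diff_right intro: subspace_diff[OF Y(2)])
    moreover have "blinfun_apply (- f) q \<le> - (blinfun_apply f p + e)"
      by (rule q(3)) (simp add: s_ge blinfun.minus_left del: minus_add_distrib)
    ultimately show False using that by (simp add: blinfun.minus_left)
  qed
  have "weakly_converges (\<lambda>n. x (r n)) p"
    unfolding weakly_converges_def
  proof (intro allI order_tendstoI)
    fix f :: "'a \<Rightarrow>\<^sub>L real" and a assume "a < blinfun_apply f p"
    then show "\<forall>\<^sub>F n in sequentially. a < blinfun_apply f (x (r n))"
      using upper[of "blinfun_apply f p - a" "- f"] by (simp add: blinfun.minus_left)
  next
    fix f :: "'a \<Rightarrow>\<^sub>L real" and a assume "blinfun_apply f p < a"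
    then show "\<forall>\<^sub>F n in sequentially. blinfun_apply f (x (r n)) < a"
      using upper[of "a - blinfun_apply f p" f] by simp
  qed
  then show ?thesis using that r p(1) by blast
qed

lemma weak_limit_in_closed_convex:
  fixes C :: "'a::real_normed_vector set"
  assumes "closed C" "convex C" "weakly_converges u w" "\<forall>\<^sub>F n in sequentially. u n \<in> C"
  shows "w \<in> C"
proof (rule ccontr)
  assume "w \<notin> C"
  then obtain f :: "'a \<Rightarrow>\<^sub>L real" and a
    where fa: "blinfun_apply f w < a" "\<And>c. c \<in> C \<Longrightarrow> a \<le> blinfun_apply f c"
    using closed_convex_separation[OF assms(1,2)] by metis
  have "(\<lambda>n. blinfun_apply f (u n)) \<longlonglongrightarrow> blinfun_apply f w"
    using assms(3) by (simp add: weakly_converges_def)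
  then have "\<forall>\<^sub>F n in sequentially. blinfun_apply f (u n) < a"
    using fa(1) by (rule order_tendstoD)
  with assms(4) have "\<forall>\<^sub>F n in sequentially. False"
    by eventually_elim (use fa(2) in fastforce)
  then show False by simp
qed

section \<open>Asymptotic balls and the uniform Kadec-Klee property\<close>

text \<open>
The set of all \<open>y\<close> with \<open>limsup \<parallel>u n - y\<parallel> \<le> s\<close>, expressed without a limit superior.
\<close>

definition asymptotic_ball :: "(nat \<Rightarrow> 'a::real_normed_vector) \<Rightarrow> real \<Rightarrow> 'a set" where
  "asymptotic_ball u s = {y. \<forall>t>s. \<forall>\<^sub>F n in sequentially. norm (u n - y) < t}"

lemma asymptotic_ballI:
  "(\<And>t. s < t \<Longrightarrow> \<forall>\<^sub>F n in sequentially. norm (u n - y) < t) \<Longrightarrow> y \<in> asymptotic_ball u s"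
  by (simp add: asymptotic_ball_def)

lemma asymptotic_ballD:
  "y \<in> asymptotic_ball u s \<Longrightarrow> s < t \<Longrightarrow> \<forall>\<^sub>F n in sequentially. norm (u n - y) < t"
  by (simp add: asymptotic_ball_def)

lemma closed_asymptotic_ball: "closed (asymptotic_ball u s)"
proof -
  have "y \<in> asymptotic_ball u s" if y: "y \<in> closure (asymptotic_ball u s)" for y
  proof (rule asymptotic_ballI)
    fix t assume "s < t"
    then obtain z where z: "z \<in> asymptotic_ball u s" "dist z y < (t - s) / 2"
      using y unfolding closure_approachable by (metis diff_gt_0_iff_gt half_gt_zero)
    have "\<forall>\<^sub>F n in sequentially. norm (u n - z) < (s + t) / 2"
      using \<open>s < t\<close> by (intro asymptotic_ballD[OF z(1)]) simp
    then show "\<forall>\<^sub>F n in sequentially. norm (u n - y) < t"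
    proof eventually_elim
      case (elim n)
      then show ?case
        using norm_triangle_ineq[of "u n - z" "z - y"] z(2) by (simp add: dist_norm field_simps)
    qed
  qed
  then show ?thesis using closure_subset_eq by blast
qed

lemma convex_asymptotic_ball: "convex (asymptotic_ball u s)"
proof (rule convexI)
  fix y z a b assume yz: "y \<in> asymptotic_ball u s" "z \<in> asymptotic_ball u s"
    and ab: "0 \<le> (a::real)" "0 \<le> b" "a + b = 1"
  show "a *\<^sub>R y + b *\<^sub>R z \<in> asymptotic_ball u s"
  proof (rule asymptotic_ballI)
    fix t assume t: "s < t"
    from asymptotic_ballD[OF yz(1) t] asymptotic_ballD[OF yz(2) t]
    show "\<forall>\<^sub>F n in sequentially. norm (u n - (a *\<^sub>R y + b *\<^sub>R z)) < t"
    proof eventually_elim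
      case (elim n)
      have "u n - (a *\<^sub>R y + b *\<^sub>R z) = (a + b) *\<^sub>R u n - (a *\<^sub>R y + b *\<^sub>R z)" by (simp add: ab)
      also have "\<dots> = a *\<^sub>R (u n - y) + b *\<^sub>R (u n - z)" by (simp add: algebra_simps)
      finally have "norm (u n - (a *\<^sub>R y + b *\<^sub>R z)) \<le> a * norm (u n - y) + b * norm (u n - z)"
        using norm_triangle_ineq[of "a *\<^sub>R (u n - y)" "b *\<^sub>R (u n - z)"] ab by simp
      also have "\<dots> < t" using elim ab by (intro convex_bound_lt)
      finally show ?case .
    qed
  qed
qed

text \<open>
If no initial segment supplies the centres of such a cover, then each index \<open>m\<close> has a successor
\<open>n > m\<close> whose term is far from all terms up to \<open>m\<close>; iterating this produces the subsequence.
\<close>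

lemma finitely_covered_or_separated_subsequence:
  fixes u :: "nat \<Rightarrow> 'a::real_normed_vector"
  obtains (covered) m where "\<And>n. m < n \<Longrightarrow> \<exists>i\<le>m. norm (u n - u i) \<le> c"
  | (separated) g :: "nat \<Rightarrow> nat" where "strict_mono g" "\<And>i j. i \<noteq> j \<Longrightarrow> c < norm (u (g i) - u (g j))"
proof (cases "\<exists>m. \<forall>n>m. \<exists>i\<le>m. norm (u n - u i) \<le> c")
  case True
  then show ?thesis using covered by blast
next
  case False
  then have step: "\<exists>n>m. \<forall>i\<le>m. c < norm (u n - u i)" for m 
    using False by (meson not_le)
  obtain succ where step: "\<And>m. m < succ m \<and> (\<forall>i\<le>m. c < norm (u (succ m) - u i))"
    using step by metis
  define g where "g k = (succ ^^ k) 0" for k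
  have g: "g k < g (Suc k) \<and> (\<forall>i\<le>g k. c < norm (u (g (Suc k)) - u i))" for k
    using step[of "g k"] by (simp add: g_def)
  have mono: "strict_mono g" using g by (simp add: strict_mono_Suc_iff)
  have lt: "c < norm (u (g j) - u (g i))" if ij: "i < j" for i j
  proof -
    obtain k where k: "j = Suc k" "i \<le> k" using ij by (cases j) auto
    then have "g i \<le> g k" using mono by (simp add: strict_mono_less_eq)
    then show ?thesis using g[of k] k by simp
  qed
  have "c < norm (u (g i) - u (g j))" if "i \<noteq> j" for i j
    using lt[of i j] lt[of j i] that by (cases "i < j") (auto simp: norm_minus_commute)
  then show ?thesis by (rule separated[OF mono])
qed

text \<open>
The property in a form for balls of radius \<open>R\<close> that are only entered eventually: drop an initial
segment and divide by \<open>R\<close>.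
\<close>

lemma uniformly_Kadec_Klee_scaled:
  assumes "uniformly_Kadec_Klee TYPE('a::real_normed_vector)" "0 < \<epsilon>"
  obtains \<delta> where "0 < \<delta>" "\<delta> < 1"
    "\<And>(x :: nat \<Rightarrow> 'a) l R c. 0 < R \<Longrightarrow> \<forall>\<^sub>F n in sequentially. norm (x n) \<le> R \<Longrightarrow> weakly_converges x l \<Longrightarrow>
       \<epsilon> * R < c \<Longrightarrow> (\<And>i j. i \<noteq> j \<Longrightarrow> c \<le> norm (x i - x j)) \<Longrightarrow> norm l \<le> (1 - \<delta>) * R"
proof -
  obtain \<delta> where \<delta>: "0 < \<delta>" "\<forall>(x :: nat \<Rightarrow> 'a) x0. (\<forall>n. x n \<in> cball 0 1) \<longrightarrow> weakly_converges x x0 \<longrightarrow>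
        Inf {norm (x n - x m) | n m. n \<noteq> m} > \<epsilon> \<longrightarrow> norm x0 \<le> 1 - \<delta>"
    using assms(1)[unfolded uniformly_Kadec_Klee_def, rule_format, OF assms(2)] by auto
  show ?thesis
  proof (rule that[of "min \<delta> (1 / 2)"])
    fix x :: "nat \<Rightarrow> 'a" and l R c
    assume R: "0 < R" and ev: "\<forall>\<^sub>F n in sequentially. norm (x n) \<le> R" and w: "weakly_converges x l"
      and c: "\<epsilon> * R < c" "\<And>i j. i \<noteq> j \<Longrightarrow> c \<le> norm (x i - x j)"
    obtain N where N: "\<And>n. N \<le> n \<Longrightarrow> norm (x n) \<le> R" using ev by (auto simp: eventually_sequentially)
    define y where "y n = (1 / R) *\<^sub>R x (n + N)" for n
    have "norm ((1 / R) *\<^sub>R l) \<le> 1 - \<delta>"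
    proof (rule \<delta>(2)[rule_format])
      show "y n \<in> cball 0 1" for n
        using N[of "n + N"] R by (simp add: y_def)
      show "weakly_converges y ((1 / R) *\<^sub>R l)"
        unfolding weakly_converges_def
      proof
        fix f :: "'a \<Rightarrow>\<^sub>L real"
        have "(\<lambda>n. blinfun_apply f (x (n + N))) \<longlonglongrightarrow> blinfun_apply f l"
          using w LIMSEQ_ignore_initial_segment unfolding weakly_converges_def by blast
        then show "(\<lambda>n. blinfun_apply f (y n)) \<longlonglongrightarrow> blinfun_apply f ((1 / R) *\<^sub>R l)"
          unfolding y_def blinfun.scaleR_right by (rule tendsto_scaleR[OF tendsto_const])
      qed
      have "c / R \<le> Inf {norm (y n - y m) | n m. n \<noteq> m}"
      proof (rule cInf_greatest)
        show "{norm (y n - y m) | n m. n \<noteq> m} \<noteq> {}" 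
          using zero_neq_one[where 'a = nat] by blast
        fix v assume "v \<in> {norm (y n - y m) | n m. n \<noteq> m}"
        then obtain n m where nm: "n \<noteq> m" "v = norm (y n - y m)" by blast
        have "v = norm ((1 / R) *\<^sub>R (x (n + N) - x (m + N)))"
          unfolding nm(2) y_def by (simp only: scaleR_right_diff_distrib)
        also have "\<dots> = norm (x (n + N) - x (m + N)) / R" using R by simp
        finally show "c / R \<le> v" using c(2)[of "n + N" "m + N"] nm(1) R by (simp add: divide_right_mono)
      qed
      moreover have "\<epsilon> < c / R" using c(1) R by (simp add: pos_less_divide_eq)
      ultimately show "\<epsilon> < Inf {norm (y n - y m) | n m. n \<noteq> m}" by simp
    qed
    then have "norm l / R \<le> 1 - min \<delta> (1 / 2)" using R by simp
    then show "norm l \<le> (1 - min \<delta> (1 / 2)) * R" using R by (simp add: pos_divide_le_eq)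
  qed (use \<delta>(1) in auto)
qed

section \<open>Iterates on a pair of parallel sets\<close>

text \<open>
The second set of the pair is \<open>A + h\<close>, and every statement about it is expressed through points of
\<open>A\<close>. In particular a sequence in \<open>A + h\<close> has its translate in \<open>A\<close> as a sequence at the constant
distance \<open>d\<close>, so the property UC becomes a statement about two sequences in \<open>A\<close>.
\<close>

locale translated_pair_iteration =
  fixes A :: "'a::banach set" and h :: 'a and d :: real and T :: "'a \<Rightarrow> 'a" and k :: "nat \<Rightarrow> real"
  assumes reflexive: "reflexive_space TYPE('a)"
    and UKK: "uniformly_Kadec_Klee TYPE('a)"
    and A: "A \<noteq> {}" "bounded A" "closed A" "convex A"
    and norm_h: "norm h = d"
    and d_le: "\<And>x y. x \<in> A \<Longrightarrow> y \<in> A \<Longrightarrow> d \<le> norm (x - (y + h))"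
    and rectangle: "\<And>x y. x \<in> A \<Longrightarrow> y \<in> A \<Longrightarrow> norm (x + h - y) = norm (y + h - x)"
    and UC: "\<And>x y. (\<And>n. x n \<in> A) \<Longrightarrow> (\<And>n. y n \<in> A) \<Longrightarrow>
      (\<lambda>n. norm (x n - (y n + h))) \<longlonglongrightarrow> d \<Longrightarrow> (\<lambda>n. norm (x n - y n)) \<longlonglongrightarrow> 0"
    and T_A: "\<And>x. x \<in> A \<Longrightarrow> T x \<in> A"
    and T_B: "\<And>x. x \<in> A \<Longrightarrow> T (x + h) - h \<in> A"
    and k_lim: "k \<longlonglongrightarrow> 1"
    and k_ge: "\<And>n. 1 \<le> k n"
    and T_le: "\<And>x y n. x \<in> A \<Longrightarrow> y \<in> A \<Longrightarrow>
      norm ((T ^^ n) x - (T ^^ n) (y + h)) \<le> k n * norm (x - (y + h))"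
begin

lemma iterate_A: "x \<in> A \<Longrightarrow> (T ^^ n) x \<in> A"
  by (induction n) (auto intro: T_A)

lemma iterate_B: "x \<in> A \<Longrightarrow> (T ^^ n) (x + h) - h \<in> A"
proof (induction n)
  case (Suc n)
  then show ?case using T_B[of "(T ^^ n) (x + h) - h"] by simp
qed simp

lemma d_nonneg: "0 \<le> d" using norm_h by auto

text \<open>
The distance of \<open>(T ^^ m) y\<close> and \<open>(T ^^ m) (y + h)\<close> lies between \<open>d\<close> and \<open>k m * d\<close>, so it tends to
\<open>d\<close> and UC applies.
\<close>

lemma iterates_track:
  assumes y: "y \<in> A"
  shows "(\<lambda>m. norm ((T ^^ m) y - ((T ^^ m) (y + h) - h))) \<longlonglongrightarrow> 0"
proof (rule UC)
  show "(T ^^ n) y \<in> A" "(T ^^ n) (y + h) - h \<in> A" for n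
    using y iterate_A iterate_B by auto
  have lower: "d \<le> norm ((T ^^ n) y - ((T ^^ n) (y + h) - h + h))" for n
    by (rule d_le) (use y iterate_A iterate_B in auto)
  have upper: "norm ((T ^^ n) y - ((T ^^ n) (y + h) - h + h)) \<le> k n * d" for n
    using T_le[OF y y, of n] norm_h by simp
  show "(\<lambda>n. norm ((T ^^ n) y - ((T ^^ n) (y + h) - h + h))) \<longlonglongrightarrow> d"
  proof (rule tendsto_sandwich[of "\<lambda>_. d" _ _ "\<lambda>n. k n * d"])
    show "(\<lambda>n. k n * d) \<longlonglongrightarrow> d" using tendsto_mult_right[OF k_lim, of d] by simp
  qed (use lower upper in auto)
qed

text \<open>
Distances from the orbit to \<open>y + h\<close> are distances from the shifted orbit to \<open>y\<close>.
\<close>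

abbreviation shifted_orbit :: "'a \<Rightarrow> nat \<Rightarrow> 'a" where
  "shifted_orbit x \<equiv> \<lambda>n. (T ^^ n) x - h"

lemma asymptotic_ball_radius_ge:
  assumes "x \<in> A" "y \<in> A" "y \<in> asymptotic_ball (shifted_orbit x) s"
  shows "d \<le> s"
proof (rule ccontr)
  assume "\<not> d \<le> s"
  then have "s < d" by simp
  from asymptotic_ballD[OF assms(3) this] obtain n where "norm ((T ^^ n) x - h - y) < d"
    by (auto simp: eventually_sequentially)
  then show False using d_le[OF iterate_A[OF assms(1), of n] assms(2)] by (simp add: algebra_simps)
qed

text \<open>
Applying \<open>T ^^ m\<close> to a tail of the orbit of \<open>x\<close> and to \<open>y + h\<close> multiplies their distance by at most
\<open>k m\<close>, and \<open>(T ^^ m) (y + h)\<close> differs from \<open>(T ^^ m) y + h\<close> by an error that tends to zero.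
\<close>

lemma iterates_in_asymptotic_ball:
  assumes x: "x \<in> A" and y: "y \<in> A" and ys: "y \<in> asymptotic_ball (shifted_orbit x) s" and "s < t"
  shows "\<forall>\<^sub>F m in sequentially. (T ^^ m) y \<in> asymptotic_ball (shifted_orbit x) t"
proof -
  define e where "e m = norm ((T ^^ m) y - ((T ^^ m) (y + h) - h))" for m
  define r where "r = (s + t) / 2"
  have r: "s < r" "r < t" using \<open>s < t\<close> by (auto simp: r_def field_simps)
  have "(\<lambda>m. k m * r + e m) \<longlonglongrightarrow> 1 * r + 0"
    unfolding e_def by (intro tendsto_add tendsto_mult k_lim tendsto_const iterates_track y)
  then have "\<forall>\<^sub>F m in sequentially. k m * r + e m < t"
    using r(2) by (intro order_tendstoD) auto
  then show ?thesis
  proof eventually_elim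
    case (elim m)
    show ?case
    proof (rule asymptotic_ballI)
      fix t' assume "t < t'"
      obtain N where N: "\<And>n. N \<le> n \<Longrightarrow> norm ((T ^^ n) x - h - y) < r"
        using asymptotic_ballD[OF ys r(1)] by (auto simp: eventually_sequentially)
      have "norm ((T ^^ n) x - h - (T ^^ m) y) < t'" if n: "N + m \<le> n" for n
      proof -
        have "n = m + (n - m)" using n by simp
        then have split: "(T ^^ n) x = (T ^^ m) ((T ^^ (n - m)) x)"
          by (metis funpow_add o_apply)
        have "norm ((T ^^ n) x - (T ^^ m) (y + h)) \<le> k m * norm ((T ^^ (n - m)) x - (y + h))"
          unfolding split by (rule T_le[OF iterate_A[OF x] y])
        also have "\<dots> \<le> k m * r"
        proof (rule mult_left_mono)
          have "N \<le> n - m" using n by simp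
          then show "norm ((T ^^ (n - m)) x - (y + h)) \<le> r"
            using N[of "n - m"] by (simp add: algebra_simps)
        qed (use k_ge[of m] in simp)
        finally have "norm ((T ^^ n) x - (T ^^ m) (y + h)) \<le> k m * r" .
        moreover have "norm ((T ^^ n) x - h - (T ^^ m) y)
            \<le> norm ((T ^^ n) x - (T ^^ m) (y + h)) + e m"
          using norm_triangle_ineq4[of "(T ^^ n) x - (T ^^ m) (y + h)" "(T ^^ m) y - ((T ^^ m) (y + h) - h)"]
          by (simp add: e_def algebra_simps)
        ultimately show ?thesis using elim \<open>t < t'\<close> by simp
      qed
      then show "\<forall>\<^sub>F n in sequentially. norm ((T ^^ n) x - h - (T ^^ m) y) < t'"
        unfolding eventually_sequentially by blast
    qed
  qed
qed

definition weak_limit_closed :: "'a set \<Rightarrow> bool" where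
  "weak_limit_closed K \<longleftrightarrow> K \<noteq> {} \<and> K \<subseteq> A \<and> closed K \<and> convex K \<and>
     (\<forall>x\<in>K. \<forall>r w. strict_mono r \<longrightarrow> weakly_converges (\<lambda>n. (T ^^ r n) x) w \<longrightarrow> w \<in> K)"

lemma minimal_weak_limit_closed:
  obtains K where "weak_limit_closed K" "\<And>L. weak_limit_closed L \<Longrightarrow> L \<subseteq> K \<Longrightarrow> L = K"
proof -
  have A_wlc: "weak_limit_closed A"
    unfolding weak_limit_closed_def
  proof (intro conjI ballI allI impI)
    fix x r w assume "x \<in> A" "weakly_converges (\<lambda>n. (T ^^ r n) x) w"
    then show "w \<in> A"
      using weak_limit_in_closed_convex[OF A(3,4), of "\<lambda>n. (T ^^ r n) x" w] iterate_A by simp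
  qed (use A in auto)
  define F where "F = {K. weak_limit_closed K}"
  have "\<exists>m\<in>F. \<forall>a\<in>F. a \<subseteq> m \<longrightarrow> a = m"
  proof (rule predicate_Zorn)
    show "partial_order_on F (relation_of (\<lambda>C D. D \<subseteq> C) F)"
      by (rule partial_order_on_relation_ofI) auto
    fix \<C> assume "\<C> \<in> Chains (relation_of (\<lambda>C D. D \<subseteq> C) F)"
    then have sub: "\<And>C. C \<in> \<C> \<Longrightarrow> weak_limit_closed C"
      and ch: "\<And>C D. C \<in> \<C> \<Longrightarrow> D \<in> \<C> \<Longrightarrow> C \<subseteq> D \<or> D \<subseteq> C"
      by (auto simp: Chains_def relation_of_def F_def)
    show "\<exists>u\<in>F. \<forall>a\<in>\<C>. u \<subseteq> a"
    proof (cases "\<C> = {}")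
      case True
      then show ?thesis using A_wlc by (auto simp: F_def)
    next
      case False
      have "\<Inter>\<C> \<noteq> {}"
      proof (rule reflexive_chain_Inter_nonempty[OF reflexive False _ ch])
        show "C \<noteq> {} \<and> bounded C \<and> closed C \<and> convex C" if "C \<in> \<C>" for C
          using sub[OF that] bounded_subset[OF A(2)] by (simp add: weak_limit_closed_def)
      qed
      moreover have "\<Inter>\<C> \<subseteq> A"
      proof -
        obtain C where "C \<in> \<C>" using False by blast
        then show ?thesis using sub[of C] by (auto simp: weak_limit_closed_def)
      qed
      moreover have "closed (\<Inter>\<C>)" "convex (\<Inter>\<C>)"
        using sub by (auto simp: weak_limit_closed_def intro!: closed_Inter convex_Inter)
      ultimately have "weak_limit_closed (\<Inter>\<C>)"
        using sub unfolding weak_limit_closed_def by blast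
      then show ?thesis by (auto simp: F_def)
    qed
  qed
  then show ?thesis using that by (auto simp: F_def)
qed

end

section \<open>Minimal sets containing the weak limits of their orbits\<close>

locale minimal_iteration = translated_pair_iteration +
  fixes K
  assumes K: "weak_limit_closed K" and K_minimal: "\<And>L. weak_limit_closed L \<Longrightarrow> L \<subseteq> K \<Longrightarrow> L = K"
begin

lemma K_subset: "K \<subseteq> A" and K_nonempty: "K \<noteq> {}" and closed_K: "closed K" and convex_K: "convex K"
  using K by (auto simp: weak_limit_closed_def)

lemma K_weak_limit:
  "x \<in> K \<Longrightarrow> strict_mono r \<Longrightarrow> weakly_converges (\<lambda>n. (T ^^ r n) x) w \<Longrightarrow> w \<in> K"
  using K unfolding weak_limit_closed_def by blast

lemma K_A: "x \<in> K \<Longrightarrow> x \<in> A"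
  using K_subset by blast

text \<open>
The part of \<open>K\<close> inside the asymptotic ball is closed and convex. By
\<open>iterates_in_asymptotic_ball\<close> it also contains the weak limits of its orbits, so minimality of \<open>K\<close>
applies to it.
\<close>

lemma asymptotic_ball_all_or_nothing:
  assumes x: "x \<in> A" and y: "y \<in> K" "y \<in> asymptotic_ball (shifted_orbit x) s"
  shows "K \<subseteq> asymptotic_ball (shifted_orbit x) s"
proof -
  let ?L = "K \<inter> asymptotic_ball (shifted_orbit x) s"
  have "weak_limit_closed ?L"
    unfolding weak_limit_closed_def
  proof (intro conjI ballI allI impI)
    show "closed ?L" by (rule closed_Int[OF closed_K closed_asymptotic_ball])
    show "convex ?L" by (rule convex_Int[OF convex_K convex_asymptotic_ball])
    fix z r w assume z: "z \<in> ?L" and r: "strict_mono r" and w: "weakly_converges (\<lambda>n. (T ^^ r n) z) w"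
    have "w \<in> asymptotic_ball (shifted_orbit x) t" if "s < t" for t
    proof (rule weak_limit_in_closed_convex[OF closed_asymptotic_ball convex_asymptotic_ball w])
      have "\<forall>\<^sub>F m in sequentially. (T ^^ m) z \<in> asymptotic_ball (shifted_orbit x) t"
        using iterates_in_asymptotic_ball[OF x] z that K_A by blast
      then show "\<forall>\<^sub>F n in sequentially. (T ^^ r n) z \<in> asymptotic_ball (shifted_orbit x) t"
        by (rule eventually_subseq[OF r])
    qed
    then have "w \<in> asymptotic_ball (shifted_orbit x) s"
      using dense unfolding asymptotic_ball_def by blast
    then show "w \<in> ?L" using K_weak_limit r w z by blast
  qed (use y K_subset in auto)
  then show ?thesis using K_minimal[of ?L] by blast
qed

text \<open>
Minimality of \<open>K\<close> makes the asymptotic radius of the shifted orbit of \<open>x\<close> about a point of \<open>K\<close>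
independent of that point.
\<close>

lemma constant_asymptotic_radius:
  obtains \<rho> where "\<And>x. x \<in> A \<Longrightarrow> d \<le> \<rho> x"
    "\<And>x y s. x \<in> A \<Longrightarrow> y \<in> K \<Longrightarrow> y \<in> asymptotic_ball (shifted_orbit x) s \<longleftrightarrow> \<rho> x \<le> s"
proof -
  have "\<exists>\<rho>\<ge>d. \<forall>y\<in>K. \<forall>s. y \<in> asymptotic_ball (shifted_orbit x) s \<longleftrightarrow> \<rho> \<le> s" if x: "x \<in> A" for x
  proof -
    define S where "S = {s. K \<inter> asymptotic_ball (shifted_orbit x) s \<noteq> {}}"
    have S_ge: "d \<le> s" if "s \<in> S" for s
      using that asymptotic_ball_radius_ge[OF x] K_A unfolding S_def by blast
    then have bdd: "bdd_below S" by (rule bdd_belowI)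
    obtain y0 where y0: "y0 \<in> K" using K_nonempty by blast
    obtain M where M: "\<And>a. a \<in> A \<Longrightarrow> norm a \<le> M" using A(2) bounded_iff by blast
    have "norm ((T ^^ n) x - h - y0) \<le> 2 * M + d" for n
      using norm_triangle_ineq4[of "(T ^^ n) x - h" y0] norm_triangle_ineq4[of "(T ^^ n) x" h]
        M[OF iterate_A[OF x, of n]] M[OF K_A[OF y0]] norm_h by linarith
    then have "y0 \<in> asymptotic_ball (shifted_orbit x) (2 * M + d)"
      by (intro asymptotic_ballI always_eventually) (auto intro: le_less_trans)
    then have ne: "S \<noteq> {}" using y0 by (auto simp: S_def)
    have "y \<in> asymptotic_ball (shifted_orbit x) s \<longleftrightarrow> Inf S \<le> s" if y: "y \<in> K" for y s
    proof
      assume "y \<in> asymptotic_ball (shifted_orbit x) s"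
      then show "Inf S \<le> s" using y bdd by (auto simp: S_def intro!: cInf_lower)
    next
      assume s: "Inf S \<le> s"
      show "y \<in> asymptotic_ball (shifted_orbit x) s"
      proof (rule asymptotic_ballI)
        fix t assume "s < t"
        then have "Inf S < t" using s by simp
        then obtain s' where s': "s' \<in> S" "s' < t" using cInf_lessD[OF ne] by blast
        then have "y \<in> asymptotic_ball (shifted_orbit x) s'"
          using asymptotic_ball_all_or_nothing[OF x] y unfolding S_def by blast
        then show "\<forall>\<^sub>F n in sequentially. norm ((T ^^ n) x - h - y) < t"
          using asymptotic_ballD s'(2) by blast
      qed
    qed
    moreover have "d \<le> Inf S" using ne S_ge by (intro cInf_greatest)
    ultimately show ?thesis by blast
  qed
  then obtain \<rho> where "\<And>x. x \<in> A \<Longrightarrow> d \<le> \<rho> x \<and>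
      (\<forall>y\<in>K. \<forall>s. y \<in> asymptotic_ball (shifted_orbit x) s \<longleftrightarrow> \<rho> x \<le> s)"
    by metis
  then show ?thesis using that by blast
qed

lemma weak_limit_in_ball:
  assumes x: "x \<in> K" and inf: "infinite {n. norm ((T ^^ n) x - a) \<le> c}"
  obtains z where "z \<in> K" "norm (a - z) \<le> c"
proof -
  define s where "s = enumerate {n. norm ((T ^^ n) x - a) \<le> c}"
  have s: "strict_mono s" unfolding s_def by (rule strict_mono_enumerate[OF inf])
  have s_in: "norm ((T ^^ s n) x - a) \<le> c" for n
    using enumerate_in_set[OF inf, of n] by (simp add: s_def)
  obtain r p where r: "strict_mono r" and p: "weakly_converges (\<lambda>n. (T ^^ s (r n)) x) p"
    using reflexive_weakly_sequentially_compact[OF reflexive A(2-4), of "\<lambda>n. (T ^^ s n) x"]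
      iterate_A[OF K_A[OF x]] by blast
  have "strict_mono (\<lambda>n. s (r n))" using strict_mono_o[OF s r] by (simp add: o_def)
  then have "p \<in> K" using K_weak_limit[OF x _ p] by blast
  moreover have "p \<in> cball a c"
    by (rule weak_limit_in_closed_convex[OF _ _ p])
      (use s_in in \<open>auto simp: dist_norm norm_minus_commute\<close>)
  ultimately show ?thesis using that by (auto simp: dist_norm)
qed

text \<open>
Each ball that is visited infinitely often contains a weak limit of the orbit, which lies in \<open>K\<close>. At
late times the orbit is within \<open>2 * c\<close> of one of these finitely many points of \<open>K\<close>, hence the shifted
orbit is within \<open>2 * c + d\<close> of it, while its distance to the others is at most about \<open>\<rho>\<close>. If
\<open>2 * c + d < \<rho>\<close>, their average is a point of \<open>K\<close> of asymptotic radius strictly below \<open>\<rho>\<close>.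
\<close>

lemma covered_orbit_radius_le:
  assumes \<rho>: "\<And>y s. y \<in> K \<Longrightarrow> y \<in> asymptotic_ball (shifted_orbit x) s \<longleftrightarrow> \<rho> \<le> s"
    and x: "x \<in> K" and cov: "\<And>n. m < n \<Longrightarrow> \<exists>i\<le>m. norm ((T ^^ n) x - (T ^^ i) x) \<le> c"
  shows "\<rho> \<le> 2 * c + d"
proof (rule ccontr)
  assume "\<not> ?thesis"
  then have gap: "2 * c + d < \<rho>" by simp
  have "\<exists>z\<in>K. \<forall>\<^sub>F n in sequentially. norm ((T ^^ n) x - (T ^^ i) x) \<le> c \<longrightarrow> norm ((T ^^ n) x - z) \<le> 2 * c" for i
  proof (cases "finite {n. norm ((T ^^ n) x - (T ^^ i) x) \<le> c}")
    case True
    then have "\<forall>\<^sub>F n in sequentially. \<not> norm ((T ^^ n) x - (T ^^ i) x) \<le> c"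
      unfolding cofinite_eq_sequentially[symmetric] eventually_cofinite by simp
    then show ?thesis using x by (auto elim: eventually_mono)
  next
    case False
    then obtain z where z: "z \<in> K" "norm ((T ^^ i) x - z) \<le> c"
      using weak_limit_in_ball[OF x] by blast
    have "norm ((T ^^ n) x - z) \<le> 2 * c" if "norm ((T ^^ n) x - (T ^^ i) x) \<le> c" for n
      using norm_triangle_ineq[of "(T ^^ n) x - (T ^^ i) x" "(T ^^ i) x - z"] z(2) that by simp
    then show ?thesis using z(1) by (intro bexI[of _ z] always_eventually allI impI)
  qed
  then have "\<forall>i. \<exists>z. z \<in> K \<and> (\<forall>\<^sub>F n in sequentially.
      norm ((T ^^ n) x - (T ^^ i) x) \<le> c \<longrightarrow> norm ((T ^^ n) x - z) \<le> 2 * c)"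
    unfolding Bex_def by simp
  from choice[OF this] obtain z where z: "\<And>i. z i \<in> K"
    "\<And>i. \<forall>\<^sub>F n in sequentially. norm ((T ^^ n) x - (T ^^ i) x) \<le> c \<longrightarrow> norm ((T ^^ n) x - z i) \<le> 2 * c"
    by blast
  define N where "N = real (Suc m)"
  have N: "0 < N" by (simp add: N_def)
  \<comment> \<open>chosen so that \<open>(2 * c + d) + (N - 1) * (\<rho> + \<eta>) \<le> N * (\<rho> - \<eta>)\<close>\<close>
  define \<eta> where "\<eta> = (\<rho> - (2 * c + d)) / (2 * N)"
  have \<eta>: "0 < \<eta>" "2 * N * \<eta> = \<rho> - (2 * c + d)" using gap N by (auto simp: \<eta>_def)
  define p where "p = (\<Sum>i\<le>m. (1 / N) *\<^sub>R z i)"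
  have "p \<in> K"
    unfolding p_def using N by (intro convex_sum convex_K z(1)) (auto simp: N_def)
  moreover have "p \<in> asymptotic_ball (shifted_orbit x) (\<rho> - \<eta>)"
  proof (rule asymptotic_ballI)
    fix t assume t: "\<rho> - \<eta> < t"
    have "\<forall>\<^sub>F n in sequentially. \<forall>i\<in>{..m}. norm ((T ^^ n) x - h - z i) < \<rho> + \<eta>"
      using \<rho>[OF z(1)] \<eta>(1)
      by (intro eventually_ball_finite ballI asymptotic_ballD[where s = \<rho>]) auto
    moreover have "\<forall>\<^sub>F n in sequentially. \<forall>i\<in>{..m}.
        norm ((T ^^ n) x - (T ^^ i) x) \<le> c \<longrightarrow> norm ((T ^^ n) x - z i) \<le> 2 * c"
      using z(2) by (intro eventually_ball_finite) auto
    ultimately show "\<forall>\<^sub>F n in sequentially. norm ((T ^^ n) x - h - p) < t"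
      using eventually_gt_at_top[of m]
    proof eventually_elim
      case (elim n)
      let ?v = "\<lambda>i. (T ^^ n) x - h - z i"
      obtain i where i: "i \<le> m" "norm ((T ^^ n) x - z i) \<le> 2 * c"
        using cov[OF elim(3)] elim(2) by auto
      have "(T ^^ n) x - h - p = (\<Sum>i\<le>m. (1 / N) *\<^sub>R ?v i)"
      proof -
        have "(\<Sum>i\<le>m. (1 / N) *\<^sub>R w) = w" for w :: 'a
          using N by (simp add: sum_constant_scaleR N_def del: of_nat_Suc)
        from this[of "(T ^^ n) x - h"] show ?thesis
          unfolding p_def by (simp only: scaleR_right_diff_distrib sum_subtractf)
      qed
      then have "norm ((T ^^ n) x - h - p) \<le> (\<Sum>i\<le>m. norm ((1 / N) *\<^sub>R ?v i))"
        by (metis norm_sum)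
      also have "\<dots> = (\<Sum>i\<le>m. norm (?v i)) / N"
        using N by (simp add: sum_divide_distrib)
      also have "(\<Sum>i\<le>m. norm (?v i)) = norm (?v i) + (\<Sum>i\<in>{..m} - {i}. norm (?v i))"
        using i(1) by (subst sum.remove[of _ i]) auto
      also have "\<dots> \<le> (2 * c + d) + real (card ({..m} - {i})) * (\<rho> + \<eta>)"
      proof (rule add_mono)
        show "norm (?v i) \<le> 2 * c + d"
          using norm_triangle_ineq4[of "(T ^^ n) x - z i" h] i(2) norm_h by (simp add: algebra_simps)
        show "(\<Sum>i\<in>{..m} - {i}. norm (?v i)) \<le> real (card ({..m} - {i})) * (\<rho> + \<eta>)"
          using elim(1) by (intro sum_bounded_above) (auto intro: less_imp_le)
      qed
      also have "\<dots> = (2 * c + d) + (N - 1) * (\<rho> + \<eta>)"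
        using i(1) by (simp add: N_def)
      also have "\<dots> \<le> N * (\<rho> - \<eta>)"
        using \<eta> by (simp add: algebra_simps)
      finally have "norm ((T ^^ n) x - h - p) \<le> \<rho> - \<eta>"
        using N by (simp add: divide_right_mono)
      then show ?case using t by simp
    qed
  qed
  ultimately show False using \<rho>[of p "\<rho> - \<eta>"] \<eta>(1) by simp
qed

text \<open>
For a separated subsequence of the orbit of \<open>x\<close> with weak limit \<open>z\<close>, the translated sequence
\<open>(T ^^ n) x - ((T ^^ m) z + h)\<close> has asymptotic norm about \<open>\<rho> x\<close>, so its weak limit
\<open>z - ((T ^^ m) z + h)\<close> has norm about \<open>(1 - \<delta>) * \<rho> x\<close> at most. The rectangle property exchanges
\<open>z\<close> and \<open>(T ^^ m) z\<close> and so turns this into a bound for \<open>\<rho> z\<close>.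
\<close>

lemma radius_decreases:
  assumes \<rho>: "\<And>x y s. x \<in> A \<Longrightarrow> y \<in> K \<Longrightarrow> y \<in> asymptotic_ball (shifted_orbit x) s \<longleftrightarrow> \<rho> x \<le> s"
    and \<epsilon>: "0 < \<epsilon>"
  obtains \<delta> where "0 < \<delta>" "\<delta> < 1"
    "\<And>x c. x \<in> K \<Longrightarrow> 0 < \<rho> x \<Longrightarrow> 2 * c + d < \<rho> x \<Longrightarrow> \<epsilon> * \<rho> x < c \<Longrightarrow> \<exists>z\<in>K. \<rho> z \<le> (1 - \<delta>) * \<rho> x"
proof -
  obtain \<delta> where \<delta>: "0 < \<delta>" "\<delta> < 1"
    "\<And>(x :: nat \<Rightarrow> 'a) l R c. 0 < R \<Longrightarrow> \<forall>\<^sub>F n in sequentially. norm (x n) \<le> R \<Longrightarrow> weakly_converges x l \<Longrightarrow>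
       \<epsilon> * R < c \<Longrightarrow> (\<And>i j. i \<noteq> j \<Longrightarrow> c \<le> norm (x i - x j)) \<Longrightarrow> norm l \<le> (1 - \<delta>) * R"
    using uniformly_Kadec_Klee_scaled[OF UKK \<epsilon>] by blast
  have "\<exists>z\<in>K. \<rho> z \<le> (1 - \<delta>) * \<rho> x"
    if x: "x \<in> K" and pos: "0 < \<rho> x" and c: "2 * c + d < \<rho> x" "\<epsilon> * \<rho> x < c" for x c
  proof (cases rule: finitely_covered_or_separated_subsequence[of "\<lambda>n. (T ^^ n) x" c, case_names covered separated])
    case (covered m)
    then have "\<rho> x \<le> 2 * c + d"
      using covered_orbit_radius_le[OF \<rho>[OF K_A[OF x]] x, of m c] by blast
    with c show ?thesis by simp
  next
    case (separated g)
    obtain r z where r: "strict_mono r" and z: "weakly_converges (\<lambda>n. (T ^^ g (r n)) x) z"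
      using reflexive_weakly_sequentially_compact[OF reflexive A(2-4), of "\<lambda>n. (T ^^ g n) x"]
        iterate_A[OF K_A[OF x]] by blast
    have gr: "strict_mono (\<lambda>n. g (r n))" using strict_mono_o[OF separated(1) r] by (simp add: o_def)
    have zK: "z \<in> K" using K_weak_limit[OF x gr z] .
    have "z \<in> asymptotic_ball (shifted_orbit z) ((1 - \<delta>) * \<rho> x)"
    proof (rule asymptotic_ballI)
      fix t assume t: "(1 - \<delta>) * \<rho> x < t"
      have "\<rho> x < min (t / (1 - \<delta>)) (c / \<epsilon>)"
        using t c(2) \<epsilon> \<delta>(2) by (simp add: pos_less_divide_eq mult.commute)
      then obtain R where R: "\<rho> x < R" "R < min (t / (1 - \<delta>)) (c / \<epsilon>)" using dense by blast
      have R_pos: "0 < R" using R(1) pos by simp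
      have Rt: "(1 - \<delta>) * R < t" and Rc: "\<epsilon> * R < c"
        using R(2) \<epsilon> \<delta>(2) by (simp_all add: pos_less_divide_eq mult.commute)
      \<comment> \<open>one radius for the iterates of \<open>z\<close>, and a larger one for the norms of the translated orbit of \<open>x\<close>\<close>
    obtain R' where R': "\<rho> x < R'" "R' < R" using dense R(1) by blast
      have "z \<in> asymptotic_ball (shifted_orbit x) (\<rho> x)" using \<rho>[OF K_A[OF x] zK] by simp
      from iterates_in_asymptotic_ball[OF K_A[OF x] K_A[OF zK] this R'(1)]
      show "\<forall>\<^sub>F m in sequentially. norm (shifted_orbit z m - z) < t"
      proof eventually_elim
        case (elim m)
        let ?a = "h + (T ^^ m) z"
        have "norm (z - ?a) \<le> (1 - \<delta>) * R"
        proof (rule \<delta>(3)[OF R_pos _ _ Rc])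
          have "\<forall>\<^sub>F n in sequentially. norm ((T ^^ n) x - ?a) \<le> R"
            using asymptotic_ballD[OF elim R'(2)] by eventually_elim (simp add: algebra_simps)
          then show "\<forall>\<^sub>F n in sequentially. norm ((T ^^ g (r n)) x - ?a) \<le> R"
            by (rule eventually_subseq[OF gr])
          show "weakly_converges (\<lambda>n. (T ^^ g (r n)) x - ?a) (z - ?a)"
            using z by (auto simp: weakly_converges_def blinfun.diff_right intro!: tendsto_diff)
          show "c \<le> norm ((T ^^ g (r i)) x - ?a - ((T ^^ g (r j)) x - ?a))" if "i \<noteq> j" for i j
            using separated(2)[of "r i" "r j"] that strict_mono_eq[OF r] by (simp add: less_imp_le)
        qed
        also have "norm (z - ?a) = norm (shifted_orbit z m - z)"
          using rectangle[OF iterate_A[OF K_A[OF zK], of m] K_A[OF zK]]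
          by (simp add: algebra_simps norm_minus_commute)
        finally show ?case using Rt by simp
      qed
    qed
    then have "\<rho> z \<le> (1 - \<delta>) * \<rho> x" using \<rho>[OF K_A[OF zK] zK] by simp
    then show ?thesis using zK by blast
  qed
  with \<delta>(1,2) show ?thesis by (rule that)
qed

text \<open>
If the infimum \<open>R\<close> were larger than \<open>d\<close>, then \<open>radius_decreases\<close> would apply with one \<open>\<delta>\<close> to all
\<open>x\<close> with \<open>\<rho> x < 2 * R\<close>, and an \<open>x\<close> with \<open>\<rho> x\<close> close to \<open>R\<close> would produce a value below \<open>R\<close>.
\<close>

lemma Inf_asymptotic_radius:
  assumes \<rho>: "\<And>x. x \<in> A \<Longrightarrow> d \<le> \<rho> x"
    "\<And>x y s. x \<in> A \<Longrightarrow> y \<in> K \<Longrightarrow> y \<in> asymptotic_ball (shifted_orbit x) s \<longleftrightarrow> \<rho> x \<le> s"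
  shows "(INF x\<in>K. \<rho> x) = d"
proof (rule ccontr)
  define R where "R = (INF x\<in>K. \<rho> x)"
  assume "(INF x\<in>K. \<rho> x) \<noteq> d"
  moreover have "d \<le> R"
    unfolding R_def using \<rho>(1) K_A by (intro cINF_greatest K_nonempty) auto
  ultimately have dR: "d < R" by (simp add: R_def)
  have R_le: "R \<le> \<rho> x" if "x \<in> K" for x
    unfolding R_def using that \<rho>(1) K_A by (intro cINF_lower bdd_belowI2[of _ d]) auto
  \<comment> \<open>any \<open>c\<close> with \<open>0 < 2 * c < R - d\<close> would do; the factor 2 in \<open>\<epsilon>\<close> leaves room for all \<open>\<rho> x < 2 * R\<close>\<close>
  define c where "c = (R - d) / 3"
  define \<epsilon> where "\<epsilon> = c / (2 * R)"
  have R: "0 < R" using dR d_nonneg by simp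
  have c: "0 < c" "2 * c + d < R" using dR by (auto simp: c_def field_simps)
  have \<epsilon>: "0 < \<epsilon>" using c R by (simp add: \<epsilon>_def)
  obtain \<delta> where \<delta>: "0 < \<delta>" "\<delta> < 1"
    "\<And>x c. x \<in> K \<Longrightarrow> 0 < \<rho> x \<Longrightarrow> 2 * c + d < \<rho> x \<Longrightarrow> \<epsilon> * \<rho> x < c \<Longrightarrow> \<exists>z\<in>K. \<rho> z \<le> (1 - \<delta>) * \<rho> x"
    using radius_decreases[OF \<rho>(2) \<epsilon>] by blast
  have "R < min (2 * R) (R / (1 - \<delta>))"
    using R \<delta>(1,2) by (simp add: pos_less_divide_eq)
  then obtain x where x: "x \<in> K" "\<rho> x < min (2 * R) (R / (1 - \<delta>))"
    unfolding R_def using cINF_less_iff[OF K_nonempty, of \<rho>] \<rho>(1) K_A by (metis bdd_belowI2)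
  have "2 * c + d < \<rho> x" "0 < \<rho> x" using c(2) R_le[OF x(1)] R by auto
  moreover have "\<epsilon> * \<rho> x < c"
  proof -
    have "\<epsilon> * \<rho> x < \<epsilon> * (2 * R)" using x(2) \<epsilon> by (intro mult_strict_left_mono) auto
    then show ?thesis using R by (simp add: \<epsilon>_def)
  qed
  ultimately obtain z where "z \<in> K" "\<rho> z \<le> (1 - \<delta>) * \<rho> x"
    using \<delta>(3)[OF x(1), of c] by blast
  moreover have "(1 - \<delta>) * \<rho> x < R"
    using x(2) \<delta>(2) by (simp add: pos_less_divide_eq mult.commute)
  ultimately show False using R_le by fastforce
qed

text \<open>
If \<open>\<rho> x\<close> is close to \<open>d\<close>, then late points of the orbit of \<open>x\<close> are at distance almost \<open>d\<close> from
\<open>y + h\<close> for any two given points \<open>y\<close> of \<open>K\<close> at once. By UC a sequence of such points converges to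
both of them, so \<open>K\<close> is a single point; its own asymptotic radius is then \<open>d\<close>, and UC applies once
more.
\<close>

lemma orbit_converges:
  obtains x where "x \<in> A" "(\<lambda>n. (T ^^ n) x) \<longlonglongrightarrow> x"
proof -
  obtain \<rho> where \<rho>: "\<And>x. x \<in> A \<Longrightarrow> d \<le> \<rho> x"
    "\<And>x y s. x \<in> A \<Longrightarrow> y \<in> K \<Longrightarrow> y \<in> asymptotic_ball (shifted_orbit x) s \<longleftrightarrow> \<rho> x \<le> s"
    using constant_asymptotic_radius by blast
  have Inf_d: "(INF x\<in>K. \<rho> x) = d" by (rule Inf_asymptotic_radius[OF \<rho>])
  have near: "\<exists>v\<in>A. \<forall>y\<in>{y1, y2}. norm (v - (y + h)) < d + 1 / real (Suc n)"
    if y: "y1 \<in> K" "y2 \<in> K" for y1 y2 n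
  proof -
    have "(INF x\<in>K. \<rho> x) < d + 1 / real (Suc n)" unfolding Inf_d by simp
    then obtain x where x: "x \<in> K" "\<rho> x < d + 1 / real (Suc n)"
      using cINF_less_iff[OF K_nonempty, of \<rho>] \<rho>(1) K_A by (metis bdd_belowI2)
    have ev: "\<forall>\<^sub>F m in sequentially. norm ((T ^^ m) x - h - y) < d + 1 / real (Suc n)" if "y \<in> K" for y
      using \<rho>(2)[OF K_A[OF x(1)] that, of "\<rho> x"] x(2) by (intro asymptotic_ballD) auto
    have "\<forall>\<^sub>F m in sequentially. norm ((T ^^ m) x - h - y1) < d + 1 / real (Suc n)
        \<and> norm ((T ^^ m) x - h - y2) < d + 1 / real (Suc n)"
      by (intro eventually_conj ev y)
    then obtain m where "norm ((T ^^ m) x - h - y1) < d + 1 / real (Suc n)"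
        "norm ((T ^^ m) x - h - y2) < d + 1 / real (Suc n)"
      unfolding eventually_sequentially by blast
    then show ?thesis
      by (intro bexI[of _ "(T ^^ m) x"] iterate_A K_A x(1)) (auto simp: algebra_simps)
  qed
  have close: "(\<lambda>n. norm (v n - y)) \<longlonglongrightarrow> 0"
    if v: "\<And>n. v n \<in> A" "\<And>n. norm (v n - (y + h)) < d + 1 / real (Suc n)" and y: "y \<in> A" for v y
  proof (rule UC[of v "\<lambda>_. y"])
    have "(\<lambda>n. d + 1 / real (Suc n)) \<longlonglongrightarrow> d + 0"
      by (intro tendsto_add tendsto_const LIMSEQ_Suc lim_1_over_n)
    then have upper: "(\<lambda>n. d + 1 / real (Suc n)) \<longlonglongrightarrow> d" by simp
    show "(\<lambda>n. norm (v n - (y + h))) \<longlonglongrightarrow> d"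
    proof (rule tendsto_sandwich[OF _ _ tendsto_const upper])
      show "\<forall>\<^sub>F n in sequentially. d \<le> norm (v n - (y + h))" using d_le[OF v(1) y] by simp
      show "\<forall>\<^sub>F n in sequentially. norm (v n - (y + h)) \<le> d + 1 / real (Suc n)"
        by (intro always_eventually allI less_imp_le v(2))
    qed
  qed (use v y in auto)
  have single: "y1 = y2" if y: "y1 \<in> K" "y2 \<in> K" for y1 y2
  proof -
    have "\<forall>n. \<exists>v. v \<in> A \<and> (\<forall>y\<in>{y1, y2}. norm (v - (y + h)) < d + 1 / real (Suc n))"
      using near[OF y] by blast
    from choice[OF this] obtain v where v: "\<And>n. v n \<in> A"
      "\<And>n y. y \<in> {y1, y2} \<Longrightarrow> norm (v n - (y + h)) < d + 1 / real (Suc n)" by blast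
    have "(\<lambda>n. norm (v n - y1)) \<longlonglongrightarrow> 0" "(\<lambda>n. norm (v n - y2)) \<longlonglongrightarrow> 0"
      using v y K_A by (auto intro!: close)
    then have "v \<longlonglongrightarrow> y1" "v \<longlonglongrightarrow> y2"
      using LIM_zero_cancel tendsto_norm_zero_iff by blast+
    then show ?thesis by (rule LIMSEQ_unique)
  qed
  obtain x where x: "x \<in> K" using K_nonempty by blast
  then have K_eq: "K = {x}" using single by blast
  then have "\<rho> x = d" using Inf_d by simp
  then have ball: "x \<in> asymptotic_ball (shifted_orbit x) d" using \<rho>(2)[OF K_A[OF x] x] by simp
  have xA: "x \<in> A" using x by (rule K_A)
  have "(\<lambda>n. norm ((T ^^ n) x - x)) \<longlonglongrightarrow> 0"
  proof (rule UC[of "\<lambda>n. (T ^^ n) x" "\<lambda>_. x"])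
    show "(\<lambda>n. norm ((T ^^ n) x - (x + h))) \<longlonglongrightarrow> d"
    proof (rule order_tendstoI)
      fix a assume "a < d"
      then show "\<forall>\<^sub>F n in sequentially. a < norm ((T ^^ n) x - (x + h))"
        using d_le[OF iterate_A[OF xA] xA]
        by (intro always_eventually allI) (rule less_le_trans)
    next
      fix a assume "d < a"
      then show "\<forall>\<^sub>F n in sequentially. norm ((T ^^ n) x - (x + h)) < a"
        using asymptotic_ballD[OF ball] by (simp add: algebra_simps)
    qed
  qed (use xA iterate_A in auto)
  then have "(\<lambda>n. (T ^^ n) x) \<longlonglongrightarrow> x"
    using LIM_zero_cancel tendsto_norm_zero_iff by blast
  then show ?thesis using that xA by blast
qed

end

section \<open>Fixed points\<close>

lemma (in translated_pair_iteration) fixed_points: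
  assumes cont: "continuous_on (A \<union> (\<lambda>a. a + h) ` A) T"
  obtains x where "x \<in> A" "T x = x" "T (x + h) = x + h"
proof -
  obtain K where "weak_limit_closed K" "\<And>L. weak_limit_closed L \<Longrightarrow> L \<subseteq> K \<Longrightarrow> L = K"
    using minimal_weak_limit_closed by blast
  then interpret minimal_iteration A h d T k K by unfold_locales
  obtain x where x: "x \<in> A" and lim: "(\<lambda>n. (T ^^ n) x) \<longlonglongrightarrow> x" using orbit_converges .
  have fixed: "T y = y"
    if y: "y \<in> A \<union> (\<lambda>a. a + h) ` A" and orbit: "\<And>n. (T ^^ n) y \<in> A \<union> (\<lambda>a. a + h) ` A"
      and y_lim: "(\<lambda>n. (T ^^ n) y) \<longlonglongrightarrow> y" for y
  proof -
    have "(\<lambda>n. T ((T ^^ n) y)) \<longlonglongrightarrow> T y"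
      by (rule continuous_on_tendsto_compose[OF cont y_lim y]) (use orbit in simp)
    moreover have "(\<lambda>n. T ((T ^^ n) y)) \<longlonglongrightarrow> y" using LIMSEQ_Suc[OF y_lim] by simp
    ultimately show ?thesis by (rule LIMSEQ_unique)
  qed
  have "(\<lambda>n. (T ^^ n) x - ((T ^^ n) (x + h) - h)) \<longlonglongrightarrow> 0"
    using iterates_track[OF x] tendsto_norm_zero_iff by blast
  from tendsto_diff[OF lim this] have "(\<lambda>n. (T ^^ n) (x + h) - h) \<longlonglongrightarrow> x" by simp
  from tendsto_add[OF this tendsto_const[of h]] have lim_h: "(\<lambda>n. (T ^^ n) (x + h)) \<longlonglongrightarrow> x + h" by simp
  have "(T ^^ n) (x + h) \<in> (\<lambda>a. a + h) ` A" for n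
    using iterate_B[OF x, of n] by (intro image_eqI[of _ _ "(T ^^ n) (x + h) - h"]) auto
  then have "T (x + h) = x + h" using x lim_h by (intro fixed) auto
  moreover have "T x = x" using x lim iterate_A[OF x] by (intro fixed) auto
  ultimately show ?thesis using that x by blast
qed

text \<open>
If \<open>y + h\<close> is proximal to \<open>x\<close>, then \<open>x + h - y\<close> and \<open>y + h - x\<close> both have norm \<open>setdist A B\<close>, and
their sum is \<open>2 *\<^sub>R h\<close>.
\<close>

lemma rectangle_norm_translation:
  fixes A :: "'a::real_normed_vector set"
  assumes B: "B = (\<lambda>a. a + h) ` A" and "A \<noteq> {}" and prox: "proximal_pair A B"
    and rect: "\<And>x y. x \<in> A \<Longrightarrow> y \<in> A \<Longrightarrow> norm (x + h - y) = norm (y + h - x)"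
  shows "norm h = setdist A B"
proof (rule order.antisym)
  obtain x where x: "x \<in> A" using \<open>A \<noteq> {}\<close> by blast
  then have "x + h \<in> B" using B by blast
  with prox x obtain y1 where "y1 \<in> B" "norm (x - y1) = setdist A B"
    unfolding proximal_pair_def by blast
  then obtain y where y: "y \<in> A" "norm (x - (y + h)) = setdist A B" using B by blast
  then have "norm (y + h - x) = setdist A B" by (simp add: norm_minus_commute)
  then have "norm (x + h - y) = setdist A B" "norm (y + h - x) = setdist A B"
    using rect[OF x y(1)] by auto
  moreover have "2 *\<^sub>R h = (x + h - y) + (y + h - x)" by (simp add: scaleR_2)
  then have "2 * norm h \<le> norm (x + h - y) + norm (y + h - x)"
    using norm_triangle_ineq[of "x + h - y" "y + h - x"] by (metis norm_scaleR abs_numeral)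
  ultimately show "norm h \<le> setdist A B" by simp
  show "setdist A B \<le> norm h"
    using setdist_le_dist[OF x \<open>x + h \<in> B\<close>] by (simp add: dist_norm)
qed

theorem theorem3p2:
  fixes A B :: "'a::banach set" and T :: "'a \<Rightarrow> 'a"
  assumes "nearly_uniformly_convex TYPE('a)"
    and "A \<noteq> {}" "bounded A" "closed A" "convex A"
    and "B \<noteq> {}" "bounded B" "closed B" "convex B"
    and "proximal_parallel_pair A B"
    and "rectangle_property A B"
    and "property_UC A B"
    and "continuous_on (A \<union> B) T"
    and "asymptotically_relatively_nonexpansive A B T"
    and "T ` A \<subseteq> A" "T ` B \<subseteq> B"
  shows "\<exists>x\<in>A. \<exists>y\<in>B. T x = x \<and> T y = y \<and> norm (x - y) = setdist A B"
proof -
  obtain h where B: "B = (\<lambda>a. a + h) ` A"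
    and rect: "\<And>x y. x \<in> A \<Longrightarrow> y \<in> A \<Longrightarrow> norm (x + h - y) = norm (y + h - x)"
    using assms(11) unfolding rectangle_property_def by blast
  have norm_h: "norm h = setdist A B"
    using rectangle_norm_translation[OF B assms(2) _ rect] assms(10)
    unfolding proximal_parallel_pair_def sharp_proximal_pair_def by blast
  obtain k :: "nat \<Rightarrow> real" where k: "\<And>n. 1 \<le> k n" "k \<longlonglongrightarrow> 1"
    "\<And>x y n. x \<in> A \<Longrightarrow> y \<in> B \<Longrightarrow> norm ((T ^^ n) x - (T ^^ n) y) \<le> k n * norm (x - y)"
    using assms(14) unfolding asymptotically_relatively_nonexpansive_def by blast
  interpret translated_pair_iteration A h "setdist A B" T k
  proof
    show "reflexive_space TYPE('a)" "uniformly_Kadec_Klee TYPE('a)"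
      using assms(1) by (auto simp: nearly_uniformly_convex_def)
    show "setdist A B \<le> norm (x - (y + h))" if "x \<in> A" "y \<in> A" for x y
      using setdist_le_dist[of x A "y + h" B] that B by (simp add: dist_norm)
    show "(\<lambda>n. norm (x n - y n)) \<longlonglongrightarrow> 0"
      if xy: "\<And>n. x n \<in> A" "\<And>n. y n \<in> A" and lim: "(\<lambda>n. norm (x n - (y n + h))) \<longlonglongrightarrow> setdist A B"
      for x y :: "nat \<Rightarrow> 'a"
    proof -
      have "(\<lambda>n. norm (y n - (y n + h))) \<longlonglongrightarrow> setdist A B" using norm_h by simp
      moreover have "\<And>n. y n + h \<in> B" using xy B by blast
      ultimately show ?thesis
        by (intro assms(12)[unfolded property_UC_def, rule_format, of x y "\<lambda>n. y n + h"] xy lim)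
    qed
    show "T x \<in> A" if "x \<in> A" for x using assms(15) that by blast
    show "T (x + h) - h \<in> A" if "x \<in> A" for x
    proof -
      have "T (x + h) \<in> B" using assms(16) that B by blast
      then show ?thesis using B by auto
    qed
    show "norm ((T ^^ n) x - (T ^^ n) (y + h)) \<le> k n * norm (x - (y + h))" if "x \<in> A" "y \<in> A" for x y n
      using k(3) that B by blast
  qed (use assms(2-5) norm_h rect k in auto)
  obtain x where x: "x \<in> A" "T x = x" "T (x + h) = x + h"
    using fixed_points assms(13) unfolding B by blast
  moreover have "x + h \<in> B" using x(1) B by blast
  moreover have "norm (x - (x + h)) = setdist A B" using norm_h by simp
  ultimately show ?thesis by blast
qed

end
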